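(* Let $n$ be a positive integer and let $\mathcal{O}\subset\mathfrak{sl}(n,\mathbb{R})$ be the adjoint orbit of a nilpotent matrix $x$ whose nilpotency index is strictly greater than $2$ (i.e. $x^2\neq 0$). Then $\mathcal{O}$ admits no Gibbs state, i.e. $\Omega_{\mathcal{O}}=\varnothing$.
   Context: The nilpotency index of a nilpotent matrix $x$ is the least $k$ with $x^k=0$. $\kappa$ denotes the Killing form of $\mathfrak{sl}(n,\mathbb{R})$. Adjoint orbits of $\mathfrak{sl}(n,\mathbb{R})$ are the orbits of $\mathrm{SL}(n,\mathbb{R})$ acting by conjugation. An adjoint orbit $\mathcal{O}$ carries the Kirillov–Kostant–Souriau symplectic form $\omega_{\mathcal{O}}$, given at $y\in\mathcal{O}$ by $\omega_{\mathcal{O}}(X^*,Y^* )(y)=\kappa(y,[X,Y])$ for $X,Y\in\mathfrak{sl}(n,\mathbb{R})$, where $X^*$ is the fundamental vector field of $X$ for the adjoint action (value $[X,y]$ at $y$, up to a sign convention that does not affect $\omega_{\mathcal{O}}$). If $\dim\mathcal{O}=2d$, the Liouville volume form is $\lambda_{\mathcal{O}}=\omega_{\mathcal{O}}^{d}$, and $|\lambda_{\mathcal{O}}|$ is the associated positive density (measure). $\Omega_{\mathcal{O}}$ is the set of $\beta\in\mathfrak{sl}(n,\mathbb{R})$ for which $Z(\beta)=\int_{\mathcal{O}} e^{-\kappa(y,\beta)}|\lambda_{\mathcal{O}}|(y)$ is finite; to each $\beta\in\Omega_{\mathcal{O}}$ is associated the probability distribution $Z(\beta)^{-1}e^{-\kappa(y,\beta)}|\lambda_{\mathcal{O}}|(y)$,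 called a Gibbs state. *)

theory Defs
  imports "HOL-Analysis.Analysis"
begin

section \<open>The Lie algebra $\mathfrak{sl}(n,\mathbb{R})$ and its Killing form\<close>

definition sl :: "(real^'n^'n) set" where
  "sl = {A. trace A = 0}"

definition lie :: "real^'n^'n \<Rightarrow> real^'n^'n \<Rightarrow> real^'n^'n" where
  "lie X Y = X ** Y - Y ** X"

text \<open>Trace of a linear endomorphism \<open>f\<close> of a finite-dimensional subspace \<open>S\<close>, computed
  in some basis; by \<open>trace_on_basis\<close> below the basis is irrelevant.\<close>

definition trace_on :: "'a::real_vector set \<Rightarrow> ('a \<Rightarrow> 'a) \<Rightarrow> real" where
  "trace_on S f =
     (let B = (SOME B. independent B \<and> span B = S) in \<Sum>b\<in>B. representation B (f b) b)"

definition killing :: "real^'n^'n \<Rightarrow> real^'n^'n \<Rightarrow> real" where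
  "killing X Y = trace_on sl (\<lambda>Z. lie X (lie Y Z))"

text \<open>The type \<open>real^'n^'n\<close> carries the componentwise product, so \<open>x ^ k\<close> is not the matrix
  power.\<close>

definition matpow :: "real^'n^'n \<Rightarrow> nat \<Rightarrow> real^'n^'n" where
  "matpow x k = ((\<lambda>y. x ** y) ^^ k) (mat 1)"

definition nilpotent_mat :: "real^'n^'n \<Rightarrow> bool" where
  "nilpotent_mat x \<longleftrightarrow> (\<exists>k. matpow x k = 0)"

definition nilpotency_index :: "real^'n^'n \<Rightarrow> nat" where
  "nilpotency_index x = (LEAST k. matpow x k = 0)"


section \<open>Adjoint orbits and the Kirillov--Kostant--Souriau form\<close>

definition adjoint_orbit :: "real^'n^'n \<Rightarrow> (real^'n^'n) set" where
  "adjoint_orbit x = {g ** x ** matrix_inv g | g. det g = 1}"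

text \<open>The tangent space at \<open>y\<close> of the orbit through \<open>y\<close>, spanned by the values at \<open>y\<close> of the
  fundamental vector fields.\<close>

definition orbit_tangent :: "real^'n^'n \<Rightarrow> (real^'n^'n) set" where
  "orbit_tangent y = (\<lambda>X. lie X y) ` sl"

definition orbit_dim :: "(real^'n^'n) set \<Rightarrow> nat" where
  "orbit_dim orb = (THE k. \<forall>y\<in>orb. dim (orbit_tangent y) = k)"

text \<open>For tangent vectors \<open>v = [X, y]\<close> and \<open>w = [Y, y]\<close> the value is \<open>\<kappa>(y, [X, Y])\<close>, which
  depends only on \<open>v\<close> and \<open>w\<close>; see \<open>kks_form_fundamental\<close> below.\<close>

definition kks_form :: "real^'n^'n \<Rightarrow> real^'n^'n \<Rightarrow> real^'n^'n \<Rightarrow> real" where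
  "kks_form y v w =
     (THE c. \<exists>X\<in>sl. \<exists>Y\<in>sl. v = lie X y \<and> w = lie Y y \<and> c = killing y (lie X Y))"

text \<open>The exterior power \<open>\<omega> \<and> \<dots> \<and> \<omega>\<close> (\<open>d\<close> factors) of a 2-form, evaluated on the vectors
  \<open>v 0, \<dots>, v (2 * d - 1)\<close>, in the normalisation
  \<open>(\<alpha> \<and> \<beta>)(v) = 1/(p! q!) \<Sum>\<sigma>. sign \<sigma> \<alpha>(v\<^sub>\<sigma>) \<beta>(v\<^sub>\<sigma>)\<close>.\<close>

definition wedge_power :: "nat \<Rightarrow> ('a \<Rightarrow> 'a \<Rightarrow> real) \<Rightarrow> (nat \<Rightarrow> 'a) \<Rightarrow> real" where
  "wedge_power d \<omega> v =
     (\<Sum>\<sigma> | \<sigma> permutes {..<2 * d}.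
        of_int (sign \<sigma>) * (\<Prod>i<d. \<omega> (v (\<sigma> (2 * i))) (v (\<sigma> (2 * i + 1))))) / 2 ^ d"


section \<open>The Liouville measure of an orbit\<close>

text \<open>The dimension of an orbit is a term and not a type, so \<open>\<real>\<^sup>k\<close> is represented by the extensional
  functions on \<open>{..<k}\<close>, that is, the underlying space of \<open>Pi\<^sub>M {..<k} (\<lambda>_. lborel)\<close>.
  A local parametrization is an injective immersion of class \<open>C\<^sup>1\<close> from an open subset
  of \<open>\<real>\<^sup>k\<close> into the orbit, where \<open>k\<close> is the dimension of the orbit.\<close>

definition partial_deriv ::
    "((nat \<Rightarrow> real) \<Rightarrow> 'a::real_normed_vector) \<Rightarrow> nat \<Rightarrow> (nat \<Rightarrow> real) \<Rightarrow> 'a" where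
  "partial_deriv \<phi> i u = vector_derivative (\<lambda>t. \<phi> (u(i := t))) (at (u i))"

definition local_parametrization ::
    "nat \<Rightarrow> 'a::real_normed_vector set \<Rightarrow> (nat \<Rightarrow> real) set \<Rightarrow> ((nat \<Rightarrow> real) \<Rightarrow> 'a) \<Rightarrow> bool" where
  "local_parametrization k orb U \<phi> \<longleftrightarrow>
     openin (product_topology (\<lambda>_. euclideanreal) {..<k}) U \<and>
     \<phi> ` U \<subseteq> orb \<and> inj_on \<phi> U \<and> continuous_on U \<phi> \<and>
     (\<forall>i<k. \<forall>u\<in>U. (\<lambda>t. \<phi> (u(i := t))) differentiable (at (u i))) \<and>
     (\<forall>i<k. continuous_on U (partial_deriv \<phi> i)) \<and>
     (\<forall>u\<in>U. inj_on (\<lambda>i. partial_deriv \<phi> i u) {..<k} \<and>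
            independent ((\<lambda>i. partial_deriv \<phi> i u) ` {..<k}))"

text \<open>The measure of the density \<open>\<bar>\<omega>\<^sup>d\<bar>\<close> on the image of one local parametrization: the
  pushforward of \<open>\<bar>\<phi>\<^sup>*\<omega>\<^sup>d\<bar>\<close>.\<close>

definition chart_measure ::
    "nat \<Rightarrow> (nat \<Rightarrow> real) set \<Rightarrow> ((nat \<Rightarrow> real) \<Rightarrow> real^'n^'n) \<Rightarrow> (real^'n^'n) measure" where
  "chart_measure d U \<phi> =
     distr
       (density (restrict_space (Pi\<^sub>M {..<2 * d} (\<lambda>_. lborel)) U)
         (\<lambda>u. ennreal \<bar>wedge_power d (kks_form (\<phi> u)) (\<lambda>i. partial_deriv \<phi> i u)\<bar>))
       borel \<phi>"

text \<open>By the change of variables formula the measures \<open>chart_measure d U \<phi>\<close> and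
  \<open>chart_measure d V \<psi>\<close> coincide on \<open>\<phi> ` U \<inter> \<psi> ` V\<close>, and countably many images \<open>\<phi> ` U\<close> cover the
  orbit. The measure obtained by gluing them is their supremum in the complete lattice of
  measures (for compatible measures on \<open>A\<close> and on \<open>B\<close>, the supremum is the glued measure on
  \<open>A \<union> B\<close>, not a sum). It is a Borel measure on the space of all matrices, concentrated on
  the orbit.\<close>

definition liouville_measure :: "(real^'n^'n) set \<Rightarrow> (real^'n^'n) measure" where
  "liouville_measure orb =
     (let d = orbit_dim orb div 2 in
      Sup {chart_measure d U \<phi> | U \<phi>. local_parametrization (2 * d) orb U \<phi>})"


section \<open>Gibbs states\<close>

definition partition_function :: "(real^'n^'n) set \<Rightarrow> real^'n^'n \<Rightarrow> ennreal" where
  "partition_function orb \<beta> = (\<integral>\<^sup>+ y. ennreal (exp (- killing y \<beta>)) \<partial>liouville_measure orb)"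

definition generalized_temperatures :: "(real^'n^'n) set \<Rightarrow> (real^'n^'n) set" where
  "generalized_temperatures orb = {\<beta> \<in> sl. partition_function orb \<beta> < \<infinity>}"

definition gibbs_state :: "(real^'n^'n) set \<Rightarrow> real^'n^'n \<Rightarrow> (real^'n^'n) measure" where
  "gibbs_state orb \<beta> =
     density (liouville_measure orb)
       (\<lambda>y. ennreal (exp (- killing y \<beta>)) / partition_function orb \<beta>)"

definition gibbs_states :: "(real^'n^'n) set \<Rightarrow> (real^'n^'n) measure set" where
  "gibbs_states orb = gibbs_state orb ` generalized_temperatures orb"


section \<open>Well-definedness\<close>

lemma trace_swap_bases:
  fixes f g :: "'a::euclidean_space \<Rightarrow> 'a"
  assumes B: "independent B" "span B = S" and C: "independent C" "span C = S"
    and f: "linear f" "f ` S \<subseteq> S" and g: "linear g" "g ` S \<subseteq> S"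
  shows "(\<Sum>b\<in>B. representation B (f (g b)) b) = (\<Sum>c\<in>C. representation C (g (f c)) c)"
proof -
  have expand: "representation E (h v) e
      = (\<Sum>d\<in>D. representation D v d * representation E (h d) e)"
    if D: "independent D" "span D = S" and E: "independent E" "span E = S"
      and h: "linear h" "h ` S \<subseteq> S" and v: "v \<in> S"
    for D E :: "'a set" and h v e
  proof -
    have fin: "finite D"
      using D(1) by (rule independent_imp_finite)
    have DS: "h d \<in> S" if "d \<in> D" for d
      using that D(2) h(2) span_base by blast
    have "v = (\<Sum>d\<in>D. representation D v d *\<^sub>R d)"
      using sum_representation_eq[OF D(1), of v D] D(2) v fin by auto
    then have "h v = h (\<Sum>d\<in>D. representation D v d *\<^sub>R d)"
      by (rule arg_cong)
    also have "\<dots> = (\<Sum>d\<in>D. representation D v d *\<^sub>R h d)"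
      using h(1) by (simp add: linear_sum linear_scale)
    finally have hv: "h v = (\<Sum>d\<in>D. representation D v d *\<^sub>R h d)" .
    have "representation E (h v) = (\<lambda>e. \<Sum>d\<in>D. representation E (representation D v d *\<^sub>R h d) e)"
      unfolding hv using E DS by (intro representation_sum) (auto intro: span_scale)
    then show ?thesis
      using E DS by (simp add: representation_scale)
  qed
  have BS: "b \<in> S" if "b \<in> B" for b using that B(2) span_base by blast
  have CS: "c \<in> S" if "c \<in> C" for c using that C(2) span_base by blast
  have "(\<Sum>b\<in>B. representation B (f (g b)) b)
      = (\<Sum>b\<in>B. \<Sum>c\<in>C. representation C (g b) c * representation B (f c) b)"
    using BS g by (intro sum.cong refl expand[OF C B f]) auto
  also have "\<dots> = (\<Sum>c\<in>C. \<Sum>b\<in>B. representation B (f c) b * representation C (g b) c)"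
    by (subst sum.swap) (simp add: mult.commute)
  also have "\<dots> = (\<Sum>c\<in>C. representation C (g (f c)) c)"
    using CS f by (intro sum.cong refl expand[OF B C g, symmetric]) auto
  finally show ?thesis .
qed

lemma trace_on_basis:
  fixes f :: "'a::euclidean_space \<Rightarrow> 'a"
  assumes "subspace S" "linear f" "f ` S \<subseteq> S" "independent B" "span B = S"
  shows "trace_on S f = (\<Sum>b\<in>B. representation B (f b) b)"
proof -
  let ?C = "SOME C. independent C \<and> span C = S"
  have C: "independent ?C \<and> span ?C = S"
    by (rule someI[of _ B]) (use assms in auto)
  show ?thesis
    using trace_swap_bases[of ?C S B f id] C assms by (simp add: trace_on_def linear_id Let_def)
qed

lemma trace_on_cyclic:
  fixes f g :: "'a::euclidean_space \<Rightarrow> 'a"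
  assumes "subspace S" "linear f" "f ` S \<subseteq> S" "linear g" "g ` S \<subseteq> S"
  shows "trace_on S (\<lambda>v. f (g v)) = trace_on S (\<lambda>v. g (f v))"
proof -
  obtain B where "independent B" "span B = S"
    using assms(1) by (metis basis_exists span_subspace)
  then show ?thesis
    using assms trace_swap_bases[of B S B f g]
    by (subst (1 2) trace_on_basis[where B = B]) (auto intro: linear_compose[unfolded o_def])
qed

lemma trace_on_diff:
  fixes f g :: "'a::euclidean_space \<Rightarrow> 'a"
  assumes "subspace S" "linear f" "f ` S \<subseteq> S" "linear g" "g ` S \<subseteq> S"
  shows "trace_on S (\<lambda>v. f v - g v) = trace_on S f - trace_on S g"
proof -
  obtain B where B: "independent B" "span B = S"
    using assms(1) by (metis basis_exists span_subspace)
  have BS: "b \<in> S" if "b \<in> B" for b using that B(2) span_base by blast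
  have "trace_on S (\<lambda>v. f v - g v) = (\<Sum>b\<in>B. representation B (f b - g b) b)"
    using assms B by (intro trace_on_basis) (auto intro: linear_compose_sub subspace_diff)
  also have "\<dots> = (\<Sum>b\<in>B. representation B (f b) b - representation B (g b) b)"
    using assms B BS by (intro sum.cong refl) (subst representation_diff; auto)
  finally show ?thesis
    using assms B by (simp add: trace_on_basis[where B = B] sum_subtractf)
qed

lemma lie_self_neg: "lie Y X = - lie X Y"
  by (simp add: lie_def)

lemma linear_lie: "linear (lie X)"
  by (rule linearI)
    (simp_all add: lie_def matrix_matrix_mult_def vec_eq_iff algebra_simps sum.distrib
      sum_distrib_left)

lemma lie_in_sl: "lie X Y \<in> sl"
  by (simp add: lie_def sl_def trace_sub trace_mul_sym[of X Y])

lemma subspace_sl: "subspace sl"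
  by (auto simp: subspace_def sl_def trace_def sum.distrib simp flip: sum_distrib_left)

lemma lie_jacobi: "lie (lie X Y) Z = lie X (lie Y Z) - lie Y (lie X Z)"
proof -
  have l: "A ** (B - C) = A ** B - A ** C" and r: "(B - C) ** A = B ** A - C ** A"
    for A B C :: "real^'n^'n"
    by (simp_all add: matrix_matrix_mult_def vec_eq_iff algebra_simps sum_subtractf)
  show ?thesis
    by (simp add: lie_def l r matrix_mul_assoc)
qed

lemma killing_diff_left: "killing (X - Y) Z = killing X Z - killing Y Z"
proof -
  have "lie (X - Y) W = lie X W - lie Y W" for W
    by (simp add: lie_def matrix_matrix_mult_def vec_eq_iff algebra_simps sum_subtractf)
  then show ?thesis
    unfolding killing_def
    by (simp add: trace_on_diff subspace_sl linear_compose[OF linear_lie linear_lie, unfolded o_def]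
        image_subset_iff lie_in_sl)
qed

lemma killing_minus_left: "killing (- X) Z = - killing X Z"
  using killing_diff_left[of 0 X Z] killing_diff_left[of 0 0 Z] by simp

lemma killing_commute: "killing X Y = killing Y X"
  unfolding killing_def
  by (rule trace_on_cyclic) (auto simp: subspace_sl linear_lie lie_in_sl)

lemma killing_invariant: "killing (lie X Y) Z = killing X (lie Y Z)"
proof -
  note lin = linear_compose[OF linear_lie linear_lie, unfolded o_def]
    linear_compose[OF linear_compose[OF linear_lie linear_lie] linear_lie, unfolded o_def]
  have "killing (lie X Y) Z
      = trace_on sl (\<lambda>W. lie X (lie Y (lie Z W)) - lie Y (lie X (lie Z W)))"
    by (simp add: killing_def lie_jacobi)
  also have "\<dots> = trace_on sl (\<lambda>W. lie X (lie Y (lie Z W))) - trace_on sl (\<lambda>W. lie Y (lie X (lie Z W)))"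
    by (rule trace_on_diff) (auto simp: subspace_sl lin lie_in_sl)
  also have "trace_on sl (\<lambda>W. lie Y (lie X (lie Z W))) = trace_on sl (\<lambda>W. lie X (lie Z (lie Y W)))"
    by (rule trace_on_cyclic) (auto simp: subspace_sl lin linear_lie lie_in_sl)
  also have "trace_on sl (\<lambda>W. lie X (lie Y (lie Z W))) - trace_on sl (\<lambda>W. lie X (lie Z (lie Y W)))
      = trace_on sl (\<lambda>W. lie X (lie Y (lie Z W)) - lie X (lie Z (lie Y W)))"
    by (rule trace_on_diff[symmetric]) (auto simp: subspace_sl lin lie_in_sl)
  also have "\<dots> = killing X (lie Y Z)"
    by (simp add: killing_def lie_jacobi linear_diff[OF linear_lie])
  finally show ?thesis .
qed

theorem kks_form_fundamental:
  assumes "X \<in> sl" "Y \<in> sl"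
  shows "kks_form y (lie X y) (lie Y y) = killing y (lie X Y)"
proof -
  have left: "killing y (lie A B) = - killing (lie A y) B" for A B
    using killing_invariant[of y A B] killing_minus_left[of "lie A y" B] lie_self_neg[of y A]
    by simp
  have right: "killing y (lie A B) = killing (lie B y) A" for A B
    using left[of B A] lie_self_neg[of B A] killing_commute[of y "lie A B"]
      killing_minus_left[of "lie B A" y] killing_commute[of y "lie B A"]
    by (metis lie_self_neg minus_minus)
  have unique: "killing y (lie X' Y') = killing y (lie X Y)"
    if "lie X y = lie X' y" "lie Y y = lie Y' y" for X' Y'
    using left[of X' Y'] left[of X Y'] right[of X Y'] right[of X Y] that by simp
  show ?thesis
    unfolding kks_form_def
  proof (rule the_equality)
    show "\<exists>X'\<in>sl. \<exists>Y'\<in>sl. lie X y = lie X' y \<and> lie Y y = lie Y' y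
        \<and> killing y (lie X Y) = killing y (lie X' Y')"
      using assms by blast
  qed (use unique in blast)
qed

lemma mult_matrix_inv:
  fixes g :: "real^'n^'n"
  assumes "det g \<noteq> 0"
  shows "g ** matrix_inv g = mat 1" "matrix_inv g ** g = mat 1"
proof -
  have "\<exists>h. g ** h = mat 1 \<and> h ** g = mat 1"
    using assms by (simp flip: invertible_def add: invertible_det_nz)
  then have "g ** matrix_inv g = mat 1 \<and> matrix_inv g ** g = mat 1"
    unfolding matrix_inv_def by (rule someI_ex)
  then show "g ** matrix_inv g = mat 1" "matrix_inv g ** g = mat 1" by auto
qed

lemma orbit_tangent_conj:
  fixes g h y :: "real^'n^'n"
  assumes gh: "g ** h = mat 1" and hg: "h ** g = mat 1"
  shows "orbit_tangent (g ** y ** h) = (\<lambda>Z. g ** Z ** h) ` orbit_tangent y"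
proof -
  have l: "A ** (B - C) = A ** B - A ** C" and r: "(B - C) ** A = B ** A - C ** A"
    for A B C :: "real^'n^'n"
    by (simp_all add: matrix_matrix_mult_def vec_eq_iff algebra_simps sum_subtractf)
  have cancel: "A ** h ** g = A" "A ** g ** h = A" for A
    by (simp_all add: gh hg flip: matrix_mul_assoc)
  have conj_lie: "g ** lie X y ** h = lie (g ** X ** h) (g ** y ** h)" for X
    by (simp add: lie_def l r matrix_mul_assoc cancel)
  have tr: "trace (A ** X ** B) = trace X" if "B ** A = mat 1" for A B X :: "real^'n^'n"
    using that trace_mul_sym[of "A ** X" B] by (simp add: matrix_mul_assoc)
  have "sl = (\<lambda>X. g ** X ** h) ` sl"
  proof (intro equalityI subsetI)
    fix X :: "real^'n^'n" assume "X \<in> sl"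
    then have "h ** X ** g \<in> sl" by (simp add: sl_def tr gh)
    moreover have "X = g ** (h ** X ** g) ** h"
      by (simp add: matrix_mul_assoc gh cancel)
    ultimately show "X \<in> (\<lambda>X. g ** X ** h) ` sl" by blast
  qed (auto simp: sl_def tr hg)
  then have "orbit_tangent (g ** y ** h)
      = (\<lambda>X. lie X (g ** y ** h)) ` ((\<lambda>X. g ** X ** h) ` sl)"
    by (simp add: orbit_tangent_def)
  then show ?thesis
    by (simp add: orbit_tangent_def image_image conj_lie)
qed

theorem orbit_dim_adjoint_orbit:
  fixes x :: "real^'n^'n"
  shows "orbit_dim (adjoint_orbit x) = dim (orbit_tangent x)"
proof -
  have const: "dim (orbit_tangent y) = dim (orbit_tangent x)" if y: "y \<in> adjoint_orbit x" for y
  proof -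
    obtain g where g: "det g = 1" "y = g ** x ** matrix_inv g"
      using y by (auto simp: adjoint_orbit_def)
    have gh: "g ** matrix_inv g = mat 1" "matrix_inv g ** g = mat 1"
      using mult_matrix_inv[of g] g(1) by simp_all
    have "linear (\<lambda>Z. A ** Z)" "linear (\<lambda>Z. Z ** A)" for A :: "real^'n^'n"
      by (rule linearI; simp add: matrix_matrix_mult_def vec_eq_iff algebra_simps sum.distrib
        sum_distrib_left)+
    from linear_compose[OF this(1)[of g] this(2)[of "matrix_inv g"]]
    have lin: "linear (\<lambda>Z. g ** Z ** matrix_inv g)"
      by (simp add: o_def)
    have inj: "inj (\<lambda>Z. g ** Z ** matrix_inv g)"
    proof (rule inj_on_inverseI)
      have "A ** matrix_inv g ** g = A" for A
        by (simp add: gh flip: matrix_mul_assoc)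
      then show "matrix_inv g ** (g ** Z ** matrix_inv g) ** g = Z" for Z
        by (simp add: matrix_mul_assoc gh)
    qed
    show ?thesis
      unfolding g(2) orbit_tangent_conj[OF gh]
      by (rule dim_image_eq[OF lin]) (use inj in \<open>auto intro: inj_on_subset\<close>)
  qed
  have x: "x \<in> adjoint_orbit x"
  proof -
    have "matrix_inv (mat 1 :: real^'n^'n) = mat 1"
      using mult_matrix_inv(1)[of "mat 1 :: real^'n^'n"] by simp
    then show ?thesis
      unfolding adjoint_orbit_def by (intro CollectI exI[of _ "mat 1"]) simp
  qed
  show ?thesis
    unfolding orbit_dim_def
  proof (rule the_equality)
    show "k = dim (orbit_tangent x)" if "\<forall>y\<in>adjoint_orbit x. dim (orbit_tangent y) = k" for k
      using bspec[OF that x] by simp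
  qed (intro ballI const)
qed

end

theory Submission
  imports Defs
begin

text \<open>Nilpotent orbits are invariant under positive dilations \<open>y \<mapsto> t y\<close>, and on an orbit of dimension
  \<open>2 d\<close> such a dilation multiplies the Liouville density by \<open>t ^ d\<close>. Hence the partition function
  at \<open>\<beta>\<close> is infinite as soon as \<open>\<kappa>(\<cdot>, \<beta>)\<close> is nonpositive on a nonempty open piece of the orbit: the
  dilates of this piece carry arbitrarily large mass and the integrand is at least \<open>1\<close> on them.
  For \<open>\<beta> = 0\<close> every piece will do. For \<open>\<beta> \<noteq> 0\<close> in \<open>sl\<close> choose \<open>p\<close> that is not an eigenvector of \<open>\<beta>\<close>
  and, using \<open>n \<ge> 3\<close>, a point \<open>y\<close> of the orbit with \<open>y p = \<beta> p\<close>; conjugation by \<open>1 + t p w\<^sup>T\<close> with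
  \<open>w \<bottom> p\<close> and \<open>w \<bullet> \<beta> p > 0\<close> then drives \<open>trace (y \<beta>)\<close> to minus infinity.
  The piece of the orbit is parametrized by \<open>A \<mapsto> (1 + A) y (1 + A)\<^sup>-\<^sup>1\<close> with \<open>A\<close> small in the span of a
  symplectic basis of a complement of the centralizer of \<open>y\<close>.\<close>

section \<open>Wedge powers and symplectic bases\<close>

text \<open>The Gram matrix of a symplectic basis ordered in consecutive pairs
  \<open>(2 * i, 2 * i + 1)\<close>: the value is 1 on such a pair, -1 on the reversed pair and 0
  otherwise.\<close>

definition std_symp :: "nat \<Rightarrow> nat \<Rightarrow> real" where
  "std_symp a b = (if a div 2 = b div 2 then real (b mod 2) - real (a mod 2) else 0)"

text \<open>These are the terms of a Pfaffian. A nonzero term comes from a permutation that maps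
  pairs to pairs; permuting whole pairs is even, and a flip inside a pair changes both the sign of
  the permutation and one factor. The induction moves the last pair back to its place.\<close>

lemma pfaffian_term_nonneg:
  assumes "\<sigma> permutes {..<2 * d}"
  shows "of_int (sign \<sigma>) * (\<Prod>i<d. std_symp (\<sigma> (2 * i)) (\<sigma> (2 * i + 1))) \<ge> 0"
  using assms
proof (induction d arbitrary: \<sigma>)
  case 0
  then show ?case by simp
next
  case (Suc d)
  let ?F = "\<lambda>\<tau>. of_int (sign \<tau>) * (\<Prod>i<Suc d. std_symp (\<tau> (2 * i)) (\<tau> (2 * i + 1)))"
  \<comment> \<open>A permutation fixing both members of the last pair restricts to the smaller
    index set, and its last factor is 1.\<close>
  have reduced: "?F \<tau> \<ge> 0" if \<tau>: "\<tau> permutes {..<2 * Suc d}" "\<tau> (2 * d) = 2 * d" "\<tau> (2 * d + 1) = 2 * d + 1" for \<tau>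
  proof -
    have "\<tau> permutes {..<2 * d}"
    proof (rule permutes_superset[OF \<tau>(1)])
      fix x assume "x \<in> {..<2 * Suc d} - {..<2 * d}"
      then have "x = 2 * d \<or> x = 2 * d + 1" by auto
      then show "\<tau> x = x" using \<tau> by auto
    qed
    from Suc.IH[OF this] show ?thesis
      using \<tau> by (simp add: std_symp_def)
  qed
  show ?case
  proof (cases "std_symp (\<sigma> (2 * d)) (\<sigma> (2 * d + 1)) = 0")
    case True
    then show ?thesis by simp
  next
    case False
    define j where "j = \<sigma> (2 * d) div 2"
    have j': "\<sigma> (2 * d + 1) div 2 = j" and mods: "\<sigma> (2 * d) mod 2 \<noteq> \<sigma> (2 * d + 1) mod 2"
      using False by (auto simp: std_symp_def j_def split: if_splits)
    have "\<sigma> (2 * d) \<in> {..<2 * Suc d}"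
      using permutes_in_image[OF Suc.prems, of "2 * d"] by simp
    then have jd: "j \<le> d" by (auto simp: j_def)
    \<comment> \<open>\<open>t\<close> exchanges the pairs number \<open>j\<close> and
      \<open>d\<close> as blocks. As two parallel transpositions it is even, and it preserves
      \<open>std_symp\<close>.\<close>
    define t where "t = Transposition.transpose (2 * j) (2 * d) \<circ> Transposition.transpose (2 * j + 1) (2 * d + 1)"
    have t_perm: "t permutes {..<2 * Suc d}"
      unfolding t_def using jd by (intro permutes_compose permutes_swap_id) auto
    have t_sign: "sign t = 1"
      unfolding t_def by (subst sign_compose) (auto simp: permutation_swap_id sign_swap_id)
    have t_div: "t a div 2 = Transposition.transpose j d (a div 2)" and t_mod: "t a mod 2 = a mod 2" for a
    proof -
      consider q where "a = 2 * q" | q where "a = 2 * q + 1"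
        by (metis evenE oddE)
      then have "t a div 2 = Transposition.transpose j d (a div 2) \<and> t a mod 2 = a mod 2"
      proof cases
        case 1
        then have "t a = 2 * Transposition.transpose j d q"
          by (simp add: t_def Transposition.transpose_def)
        then show ?thesis using 1 by simp
      next
        case 2
        then have "t a = 2 * Transposition.transpose j d q + 1"
          by (simp add: t_def Transposition.transpose_def)
        then show ?thesis using 2 by simp
      qed
      then show "t a div 2 = Transposition.transpose j d (a div 2)" "t a mod 2 = a mod 2" by auto
    qed
    have t_symp: "std_symp (t a) (t b) = std_symp a b" for a b
      by (auto simp: std_symp_def t_div t_mod Transposition.transpose_def)
    define \<tau> where "\<tau> = t \<circ> \<sigma>"
    have \<tau>_perm: "\<tau> permutes {..<2 * Suc d}"
      unfolding \<tau>_def by (rule permutes_compose[OF Suc.prems t_perm])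
    have perm: "permutation \<sigma>" "permutation t" "permutation \<tau>"
      using Suc.prems t_perm \<tau>_perm by (auto simp: permutation_permutes)
    have F_eq: "?F \<tau> = ?F \<sigma>"
      unfolding \<tau>_def using perm by (simp add: t_symp sign_compose t_sign)
    have \<tau>_div: "\<tau> (2 * d) div 2 = d" "\<tau> (2 * d + 1) div 2 = d"
      using j' by (auto simp: \<tau>_def t_div j_def[symmetric])
    have \<tau>_mod: "\<tau> (2 * d) mod 2 \<noteq> \<tau> (2 * d + 1) mod 2"
      using mods by (simp add: \<tau>_def t_mod)
    have "(a = 2 * d \<and> b = 2 * d + 1) \<or> (a = 2 * d + 1 \<and> b = 2 * d)"
      if "a div 2 = d" "b div 2 = d" "a mod 2 \<noteq> b mod 2" for a b :: nat
      using that by presburger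
    from this[OF \<tau>_div \<tau>_mod]
    consider "\<tau> (2 * d) = 2 * d" "\<tau> (2 * d + 1) = 2 * d + 1" | "\<tau> (2 * d) = 2 * d + 1" "\<tau> (2 * d + 1) = 2 * d"
      by blast
    then show ?thesis
    proof cases
      case 1
      then show ?thesis using reduced[OF \<tau>_perm] F_eq by simp
    next
      case 2
      \<comment> \<open>Flipping the last pair changes the sign of the permutation and the sign of
        the last factor, so the term is unchanged.\<close>
      define \<rho> where "\<rho> = Transposition.transpose (2 * d) (2 * d + 1) \<circ> \<tau>"
      have \<rho>_perm: "\<rho> permutes {..<2 * Suc d}"
        unfolding \<rho>_def by (intro permutes_compose[OF \<tau>_perm] permutes_swap_id) auto
      have \<rho>_sign: "sign \<rho> = - sign \<tau>"
        unfolding \<rho>_def using perm by (simp add: sign_compose permutation_swap_id sign_swap_id)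
      have same: "\<rho> a = \<tau> a" if "a < 2 * d" for a
      proof -
        have "\<tau> a \<noteq> \<tau> (2 * d)" "\<tau> a \<noteq> \<tau> (2 * d + 1)"
          using that by (simp_all add: inj_eq[OF permutes_inj[OF \<tau>_perm]])
        then show ?thesis using 2 by (simp add: \<rho>_def)
      qed
      have "?F \<rho> = ?F \<tau>"
        using 2 by (simp add: \<rho>_sign same) (simp add: \<rho>_def std_symp_def)
      then show ?thesis
        using reduced[OF \<rho>_perm] 2 F_eq by (simp add: \<rho>_def)
    qed
  qed
qed

text \<open>No cancellation can occur, since every term is nonnegative and the identity permutation
  contributes 1.\<close>

lemma wedge_power_std_symp_pos:
  assumes "\<And>i j. i < 2 * d \<Longrightarrow> j < 2 * d \<Longrightarrow> \<omega> (v i) (v j) = std_symp i j"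
  shows "wedge_power d \<omega> v > 0"
proof -
  let ?P = "{\<sigma>. \<sigma> permutes {..<2 * d}}"
  let ?F = "\<lambda>\<sigma>. of_int (sign \<sigma>) * (\<Prod>i<d. std_symp (\<sigma> (2 * i)) (\<sigma> (2 * i + 1)))"
  have "(\<Sum>\<sigma>\<in>?P. of_int (sign \<sigma>) * (\<Prod>i<d. \<omega> (v (\<sigma> (2 * i))) (v (\<sigma> (2 * i + 1))))) = (\<Sum>\<sigma>\<in>?P. ?F \<sigma>)"
  proof (intro sum.cong refl arg_cong2[where f = "(*)"] prod.cong)
    fix \<sigma> i assume "\<sigma> \<in> ?P" "i \<in> {..<d}"
    then have "\<sigma> (2 * i) < 2 * d" "\<sigma> (2 * i + 1) < 2 * d"
      using permutes_in_image[of \<sigma> "{..<2 * d}" "2 * i"] permutes_in_image[of \<sigma> "{..<2 * d}" "2 * i + 1"]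
      by auto
    then show "\<omega> (v (\<sigma> (2 * i))) (v (\<sigma> (2 * i + 1))) = std_symp (\<sigma> (2 * i)) (\<sigma> (2 * i + 1))"
      by (rule assms)
  qed
  moreover have "(\<Sum>\<sigma>\<in>?P. ?F \<sigma>) > 0"
  proof (rule sum_pos2[where i = id])
    show "?F id > 0" by (simp add: std_symp_def sign_id)
  next
    show "0 \<le> ?F \<sigma>" if "\<sigma> \<in> ?P" for \<sigma>
      using pfaffian_term_nonneg[of \<sigma> d] that by simp
  qed (auto simp: finite_permutations permutes_id)
  ultimately show ?thesis by (simp add: wedge_power_def)
qed

text \<open>Each term has \<open>d\<close> factors of the form. Allowing two different vector
  families makes it possible to pass from tangent vectors to the matrices inducing them while the
  base point is scaled.\<close>

lemma wedge_power_scale: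
  assumes "\<And>i j. i < 2 * d \<Longrightarrow> j < 2 * d \<Longrightarrow> \<omega>' (w i) (w j) = t * \<omega> (v i) (v j)"
  shows "wedge_power d \<omega>' w = t ^ d * wedge_power d \<omega> v"
proof -
  have "(\<Prod>i<d. \<omega>' (w (\<sigma> (2 * i))) (w (\<sigma> (2 * i + 1)))) = t ^ d * (\<Prod>i<d. \<omega> (v (\<sigma> (2 * i))) (v (\<sigma> (2 * i + 1))))"
    if "\<sigma> permutes {..<2 * d}" for \<sigma>
  proof -
    have "\<omega>' (w (\<sigma> (2 * i))) (w (\<sigma> (2 * i + 1))) = t * \<omega> (v (\<sigma> (2 * i))) (v (\<sigma> (2 * i + 1)))" if "i < d" for i
      using that permutes_in_image[OF \<open>\<sigma> permutes _\<close>, of "2 * i"] permutes_in_image[OF \<open>\<sigma> permutes _\<close>, of "2 * i + 1"]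
      by (intro assms) auto
    then show ?thesis by (simp add: prod.distrib)
  qed
  then show ?thesis
    by (simp add: wedge_power_def sum_distrib_left mult.left_commute)
qed

text \<open>For fixed \<open>k\<close> only the other member of its pair contributes, which
  collapses sums over \<open>i\<close> to one term.\<close>

lemma std_symp_partner:
  "std_symp i k = (if i = (if even k then k + 1 else k - 1) then (if even k then -1 else 1) else 0)"
  unfolding std_symp_def by (auto elim!: evenE oddE) presburger+

lemma independent_family:
  fixes v :: "nat \<Rightarrow> 'a::real_vector"
  assumes "\<And>c i. (\<Sum>i<k. c i *\<^sub>R v i) = 0 \<Longrightarrow> i < k \<Longrightarrow> c i = 0"
  shows "inj_on v {..<k}" "independent (v ` {..<k})"
proof -
  show inj: "inj_on v {..<k}"
  proof (rule inj_onI, rule ccontr)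
    fix i j assume ij: "i \<in> {..<k}" "j \<in> {..<k}" "v i = v j" "i \<noteq> j"
    let ?c = "\<lambda>l. if l = i then 1 else if l = j then -1 else (0 :: real)"
    have "(\<Sum>l<k. ?c l *\<^sub>R v l) = (\<Sum>l\<in>{i, j}. ?c l *\<^sub>R v l)"
      using ij(1,2) by (intro sum.mono_neutral_right) auto
    also have "\<dots> = 0" using ij(3,4) by simp
    finally show False using assms[of ?c i] ij(1) by simp
  qed
  show "independent (v ` {..<k})"
  proof (rule independent_if_scalars_zero)
    fix f x assume "(\<Sum>x\<in>v ` {..<k}. f x *\<^sub>R x) = 0" "x \<in> v ` {..<k}"
    then show "f x = 0" using assms[of "\<lambda>i. f (v i)"] by (auto simp: sum.reindex[OF inj])
  qed simp
qed

text \<open>A symplectic family of maximal length spans a complement of the radical: a remainder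
  outside the radical would supply one more pair. The coefficients are pairings with family members,
  hence linear and zero on the radical.\<close>

lemma symplectic_family_split:
  fixes B :: "'a::euclidean_space \<Rightarrow> 'a \<Rightarrow> real"
  assumes B: "bilinear B" and alt: "\<And>u. B u u = 0"
  obtains d :: nat and X :: "nat \<Rightarrow> 'a" and coef :: "nat \<Rightarrow> 'a \<Rightarrow> real" where
    "\<And>i j. i < 2 * d \<Longrightarrow> j < 2 * d \<Longrightarrow> B (X i) (X j) = std_symp i j"
    "\<And>i. linear (coef i)"
    "\<And>i j. i < 2 * d \<Longrightarrow> j < 2 * d \<Longrightarrow> coef i (X j) = (if i = j then 1 else 0)"
    "\<And>i Z. (\<And>W. B Z W = 0) \<Longrightarrow> coef i Z = 0"
    "\<And>Z W. B (Z - (\<Sum>i<2 * d. coef i Z *\<^sub>R X i)) W = 0"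
proof -
  have linl: "linear (\<lambda>u. B u w)" and linr: "linear (B w)" for w
    using B by (auto simp: bilinear_def)
  have skew: "B u w = - B w u" for u w
    using alt[of "u + w"] alt[of u] alt[of w]
    by (simp add: linear_add[OF linl] linear_add[OF linr])
  define P where "P d X \<longleftrightarrow> (\<forall>i<2 * d. \<forall>j<2 * d. B (X i) (X j) = std_symp i j)" for d :: nat and X :: "nat \<Rightarrow> 'a"
  \<comment> \<open>The coordinate along \<open>X i\<close> is read off by pairing with its partner;
    the sign for odd \<open>i\<close> compensates the skew symmetry.\<close>
  define coef where "coef X i Z = (if even i then B Z (X (i + 1)) else - B Z (X (i - 1)))"
    for X :: "nat \<Rightarrow> 'a" and i Z
  have coef_linear: "linear (coef X i)" for X i
    unfolding coef_def using linl linear_compose_neg[OF linl] by (cases "even i") auto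
  have coef_X: "coef X i (X j) = (if i = j then 1 else 0)" if "P d X" "i < 2 * d" "j < 2 * d" for d X i j
  proof (cases "even i")
    case True
    then have "i + 1 < 2 * d" using that(2) by (auto elim!: evenE)
    then have "coef X i (X j) = std_symp j (i + 1)" using True that by (simp add: coef_def P_def)
    then show ?thesis using True by (auto simp: std_symp_partner)
  next
    case False
    then have "i - 1 < 2 * d" using that(2) by auto
    then have "coef X i (X j) = - std_symp j (i - 1)" using False that by (simp add: coef_def P_def)
    then show ?thesis using False by (auto simp: std_symp_partner elim!: oddE)
  qed
  \<comment> \<open>Symplectic families are linearly independent, so their length is bounded and a
    longest one exists.\<close>
  have bound: "d \<le> DIM('a)" if "P d X" for d X
  proof -
    have zero: "c k = 0" if c: "(\<Sum>i<2 * d. c i *\<^sub>R X i) = 0" "k < 2 * d" for c k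
    proof -
      have "coef X k (\<Sum>i<2 * d. c i *\<^sub>R X i) = 0"
        using c(1) by (simp add: linear_0[OF coef_linear])
      then have "(\<Sum>i<2 * d. c i * coef X k (X i)) = 0"
        by (simp add: linear_sum[OF coef_linear] linear_scale[OF coef_linear])
      moreover have "(\<Sum>i<2 * d. c i * coef X k (X i)) = (\<Sum>i<2 * d. if i = k then c k else 0)"
        by (intro sum.cong refl) (auto simp: coef_X[OF \<open>P d X\<close> c(2)])
      ultimately show ?thesis using c(2) by (simp add: sum.delta)
    qed
    have "inj_on X {..<2 * d}" by (rule independent_family(1)) (rule zero)
    moreover have "independent (X ` {..<2 * d})" by (rule independent_family(2)) (rule zero)
    ultimately show ?thesis
      using independent_bound[of "X ` {..<2 * d}"] card_image[of X "{..<2 * d}"] by simp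
  qed
  have "\<exists>X. P 0 X" by (simp add: P_def)
  moreover have "d \<le> DIM('a)" if "\<exists>X. P d X" for d
    using that bound by fastforce
  ultimately obtain d where d: "\<exists>X. P d X" and dmax: "\<And>d'. \<exists>X. P d' X \<Longrightarrow> d' \<le> d"
    using GreatestI_nat[of "\<lambda>d. \<exists>X. P d X" 0 "DIM('a)"] Greatest_le_nat[of "\<lambda>d. \<exists>X. P d X" _ "DIM('a)"]
    by metis
  then obtain X where X: "P d X" by blast
  define rest where "rest Z = Z - (\<Sum>i<2 * d. coef X i Z *\<^sub>R X i)" for Z
  have rest_X: "B (rest Z) (X k) = 0" if k: "k < 2 * d" for Z k
  proof -
    let ?p = "if even k then k + 1 else k - 1"
    have p: "?p < 2 * d" using k by (auto elim!: evenE)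
    have "B (\<Sum>i<2 * d. coef X i Z *\<^sub>R X i) (X k) = (\<Sum>i<2 * d. coef X i Z * std_symp i k)"
      using k X by (simp add: linear_sum[OF linl] linear_scale[OF linl] P_def)
    also have "\<dots> = (\<Sum>i<2 * d. if i = ?p then coef X ?p Z * (if even k then -1 else 1) else 0)"
      by (intro sum.cong refl) (auto simp: std_symp_partner)
    also have "\<dots> = B Z (X k)" using p by (simp add: sum.delta coef_def)
    finally show ?thesis by (simp add: rest_def linear_diff[OF linl])
  qed
  show ?thesis
  proof (rule that[of d X "coef X"])
    show "B (Z - (\<Sum>i<2 * d. coef X i Z *\<^sub>R X i)) W = 0" for Z W
    proof (rule ccontr)
      assume "B (Z - (\<Sum>i<2 * d. coef X i Z *\<^sub>R X i)) W \<noteq> 0"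
      then have nz: "B (rest Z) W \<noteq> 0" by (simp add: rest_def)
      \<comment> \<open>\<open>W'\<close> is made orthogonal to the whole family and normalised to
        pair to 1 with \<open>rest Z\<close>; the two form the additional pair.\<close>
      define W' where "W' = (1 / B (rest Z) W) *\<^sub>R rest W"
      have W'X: "B W' (X k) = 0" if "k < 2 * d" for k
        using rest_X[OF that] by (simp add: W'_def linear_scale[OF linl])
      have "B (rest Z) (rest W) = B (rest Z) W"
        using rest_X by (simp add: rest_def[of W] linear_diff[OF linr] linear_sum[OF linr] linear_scale[OF linr])
      then have ZW': "B (rest Z) W' = 1"
        using nz by (simp add: W'_def linear_scale[OF linr])
      define Y where "Y = X(2 * d := rest Z, 2 * d + 1 := W')"
      have "P (Suc d) Y"
        unfolding P_def
      proof (intro allI impI)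
        fix i j assume "i < 2 * Suc d" "j < 2 * Suc d"
        then have "i < 2 * d \<or> i = 2 * d \<or> i = 2 * d + 1" "j < 2 * d \<or> j = 2 * d \<or> j = 2 * d + 1"
          by auto
        then show "B (Y i) (Y j) = std_symp i j"
          using X rest_X W'X ZW' skew[of W' "rest Z"] skew[of "X _" W'] skew[of "X _" "rest Z"]
          by (auto simp: Y_def P_def alt) (auto simp: std_symp_def)
      qed
      then show False using dmax[of "Suc d"] by auto
    qed
    show "coef X i Z = 0" if "\<And>W. B Z W = 0" for i Z
      using that by (simp add: coef_def)
  qed (use X coef_linear coef_X[OF X] in \<open>auto simp: P_def\<close>)
qed

section \<open>The Killing form as a trace form\<close>

lemma bilinear_matrix_mult: "bilinear (\<lambda>A B :: real^'n^'n. A ** B)"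
  unfolding bilinear_def
  by (intro conjI allI linearI)
    (simp_all add: matrix_matrix_mult_def vec_eq_iff algebra_simps sum.distrib sum_distrib_left)

lemmas bounded_bilinear_matrix_mult =
  bilinear_conv_bounded_bilinear[THEN iffD1, OF bilinear_matrix_mult]

lemmas matrix_ring_simps =
  bounded_bilinear.add_left[OF bounded_bilinear_matrix_mult]
  bounded_bilinear.add_right[OF bounded_bilinear_matrix_mult]
  bounded_bilinear.diff_left[OF bounded_bilinear_matrix_mult]
  bounded_bilinear.diff_right[OF bounded_bilinear_matrix_mult]
  bounded_bilinear.minus_left[OF bounded_bilinear_matrix_mult]
  bounded_bilinear.minus_right[OF bounded_bilinear_matrix_mult]
  bounded_bilinear.scaleR_left[OF bounded_bilinear_matrix_mult]
  bounded_bilinear.scaleR_right[OF bounded_bilinear_matrix_mult]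
  bounded_bilinear.zero_left[OF bounded_bilinear_matrix_mult]
  bounded_bilinear.zero_right[OF bounded_bilinear_matrix_mult]

lemma linear_trace: "linear (trace :: real^'n^'n \<Rightarrow> real)"
  by (rule linearI) (simp_all add: trace_def sum.distrib sum_distrib_left)

lemmas trace_linear_simps =
  linear_add[OF linear_trace] linear_diff[OF linear_trace] linear_scale[OF linear_trace]
  linear_neg[OF linear_trace] linear_0[OF linear_trace]

lemma bilinear_lie: "bilinear (lie :: real^'n^'n \<Rightarrow> _)"
  unfolding bilinear_def
  by (intro conjI allI linearI) (simp_all add: lie_def matrix_ring_simps scaleR_diff_right)

lemma trace_on_UNIV:
  fixes f :: "'a::euclidean_space \<Rightarrow> 'a"
  assumes "linear f"
  shows "trace_on UNIV f = (\<Sum>b\<in>Basis. f b \<bullet> b)"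
proof -
  have "trace_on UNIV f = (\<Sum>b\<in>Basis. representation Basis (f b) b)"
    by (rule trace_on_basis) (auto simp: assms independent_Basis)
  also have "\<dots> = (\<Sum>b\<in>Basis. f b \<bullet> b)"
  proof (intro sum.cong refl)
    fix b :: 'a assume b: "b \<in> Basis"
    have "(\<Sum>d\<in>Basis. representation Basis (f b) d *\<^sub>R d) = f b"
      by (rule sum_representation_eq) (auto simp: independent_Basis)
    then have "f b \<bullet> b = (\<Sum>d\<in>Basis. representation Basis (f b) d *\<^sub>R d) \<bullet> b" by simp
    also have "\<dots> = representation Basis (f b) b"
      using b by (simp add: inner_sum_left inner_Basis if_distrib sum.delta cong: if_cong)
    finally show "representation Basis (f b) b = f b \<bullet> b" by simp
  qed
  finally show ?thesis .
qed

text \<open>The scalar matrices complement \<open>sl\<close>, so a map annihilating them has the same trace on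
  \<open>sl\<close> as on the space of all matrices.\<close>

lemma trace_on_sl:
  fixes f :: "real^'n^'n \<Rightarrow> real^'n^'n"
  assumes f: "linear f" and sl: "range f \<subseteq> sl" and one: "f (mat 1) = 0"
  shows "trace_on sl f = (\<Sum>b\<in>Basis. f b \<bullet> b)"
proof -
  obtain B :: "(real^'n^'n) set" where B: "independent B" "span B = sl"
    using subspace_sl by (metis basis_exists span_subspace)
  have one_sl: "mat 1 \<notin> span B"
    unfolding B(2) by (simp add: sl_def trace_I)
  define C where "C = insert (mat 1) B"
  have C: "independent C" unfolding C_def using B(1) one_sl by (simp add: independent_insert)
  have "A \<in> span C" for A :: "real^'n^'n"
  proof -
    have "A - (trace A / CARD('n)) *\<^sub>R mat 1 \<in> span B"
      by (simp add: B(2) sl_def trace_linear_simps trace_I)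
    then show ?thesis
      unfolding C_def span_breakdown_eq by blast
  qed
  then have spanC: "span C = UNIV" by blast
  have finB: "finite B" using B(1) by (rule independent_imp_finite)
  \<comment> \<open>In the basis of \<open>sl\<close> completed by the identity matrix, the identity
    contributes 0 because \<open>f\<close> annihilates it, and the other diagonal coefficients agree
    with those in \<open>B\<close> because \<open>f\<close> takes values in
    \<open>sl\<close>.\<close>
  have "trace_on UNIV f = (\<Sum>b\<in>C. representation C (f b) b)"
    by (rule trace_on_basis) (use f C spanC in auto)
  also have "\<dots> = (\<Sum>b\<in>B. representation C (f b) b)"
    unfolding C_def using finB one_sl span_base[of "mat 1" B]
    by (subst sum.insert) (auto simp: one representation_zero)
  also have "\<dots> = (\<Sum>b\<in>B. representation B (f b) b)"
    using C sl B(2) by (intro sum.cong refl fun_cong[OF representation_extend]) (auto simp: C_def)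
  also have "\<dots> = trace_on sl f"
    by (rule trace_on_basis[symmetric]) (use f sl B subspace_sl in auto)
  finally show ?thesis by (simp add: trace_on_UNIV f)
qed

lemma sum_Basis_matrix:
  fixes f :: "real^'n^'n \<Rightarrow> real"
  shows "(\<Sum>b\<in>Basis. f b) = (\<Sum>i\<in>UNIV. \<Sum>j\<in>UNIV. f (axis i (axis j 1)))"
proof -
  let ?h = "\<lambda>(i, j). axis i (axis j 1) :: real^'n^'n"
  have "(Basis :: (real^'n^'n) set) = ?h ` (UNIV \<times> UNIV)"
    by (auto simp: Basis_vec_def image_iff)
  moreover have "inj_on ?h (UNIV \<times> UNIV)"
    by (auto simp: inj_on_def axis_eq_axis)
  ultimately have "(\<Sum>b\<in>Basis. f b) = sum (f \<circ> ?h) (UNIV \<times> UNIV)"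
    using sum.reindex by metis
  then show ?thesis
    unfolding sum.cartesian_product by (simp only: o_def split_def)
qed

text \<open>The map \<open>b \<mapsto> A ** b ** B\<close> is the tensor product of \<open>A\<close>
  with the transpose of \<open>B\<close>, so its trace is multiplicative. Concretely, each matrix
  unit contributes one product of diagonal entries.\<close>

lemma trace_two_sided_mult:
  fixes A B :: "real^'n^'n"
  shows "(\<Sum>b\<in>Basis. (A ** b ** B) \<bullet> b) = trace A * trace B"
proof -
  have entry: "(A ** axis i (axis j 1) ** B) \<bullet> axis i (axis j 1) = A $ i $ i * B $ j $ j" for i j
  proof -
    have "(A ** axis i (axis j 1) ** B) \<bullet> axis i (axis j 1) = (A ** axis i (axis j 1) ** B) $ i $ j"
      by (simp add: inner_axis)
    also have "\<dots> = (\<Sum>k\<in>UNIV. (\<Sum>l\<in>UNIV. A $ i $ l * axis i (axis j 1) $ l $ k) * B $ k $ j)"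
      by (simp add: matrix_matrix_mult_def)
    also have "\<dots> = (\<Sum>k\<in>UNIV. (\<Sum>l\<in>UNIV. if l = i then A $ i $ l * (if k = j then 1 else 0) else 0) * B $ k $ j)"
      by (intro sum.cong refl arg_cong2[where f = "(*)"]) (auto simp: axis_def)
    also have "\<dots> = (\<Sum>k\<in>UNIV. if k = j then A $ i $ i * B $ k $ j else 0)"
      by (intro sum.cong refl) (simp add: sum.delta)
    also have "\<dots> = A $ i $ i * B $ j $ j"
      by (simp add: sum.delta)
    finally show ?thesis .
  qed
  show ?thesis
    by (simp add: sum_Basis_matrix entry trace_def sum_product)
qed

text \<open>The composite of two brackets expands into four two-sided multiplications, each of known
  trace. On trace-free matrices this is the classical \<open>2 n trace (X ** Y)\<close>.\<close>

theorem killing_eq_trace: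
  fixes X Y :: "real^'n^'n"
  shows "killing X Y = 2 * CARD('n) * trace (X ** Y) - 2 * trace X * trace Y"
proof -
  let ?f = "\<lambda>Z. lie X (lie Y Z)"
  have expand: "?f Z = (X ** Y) ** Z ** mat 1 - X ** Z ** Y - Y ** Z ** X + mat 1 ** Z ** (Y ** X)" for Z
    by (simp add: lie_def matrix_ring_simps matrix_mul_assoc)
  have "killing X Y = (\<Sum>b\<in>Basis. ?f b \<bullet> b)"
    unfolding killing_def
    by (rule trace_on_sl)
      (auto simp: linear_compose[OF linear_lie linear_lie, unfolded o_def] lie_in_sl,
       simp add: lie_def)
  also have "\<dots> = (\<Sum>b\<in>Basis. ((X ** Y) ** b ** mat 1) \<bullet> b - (X ** b ** Y) \<bullet> b - (Y ** b ** X) \<bullet> b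
      + (mat 1 ** b ** (Y ** X)) \<bullet> b)"
    by (intro sum.cong refl, unfold expand)
      (simp only: inner_diff_left inner_add_left)
  also have "\<dots> = 2 * CARD('n) * trace (X ** Y) - 2 * trace X * trace Y"
    by (simp only: sum.distrib sum_subtractf trace_two_sided_mult) (simp add: trace_I trace_mul_sym[of Y X])
  finally show ?thesis .
qed

text \<open>Scalar matrices are central, so subtracting one makes the trace vanish without changing
  any bracket. This allows fundamental fields of arbitrary matrices, such as those produced by the
  charts.\<close>

lemma lie_remove_trace:
  fixes X :: "real^'n^'n"
  obtains X' where "X' \<in> sl" "\<And>Y. lie X' Y = lie X Y" "\<And>Y. lie Y X' = lie Y X"
proof
  let ?X = "X - (trace X / CARD('n)) *\<^sub>R mat 1"
  show "?X \<in> sl" by (simp add: sl_def trace_linear_simps trace_I)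
  show "lie ?X Y = lie X Y" "lie Y ?X = lie Y X" for Y by (simp_all add: lie_def matrix_ring_simps)
qed

lemma kks_form_eq_trace:
  fixes y X Y :: "real^'n^'n"
  shows "kks_form y (lie X y) (lie Y y) = 2 * CARD('n) * trace (y ** lie X Y)"
proof -
  obtain X' Y' where X': "X' \<in> sl" "\<And>Y. lie X' Y = lie X Y" 
    and Y': "Y' \<in> sl" "\<And>X. lie Y' X = lie Y X" "\<And>X. lie X Y' = lie X Y"
    using lie_remove_trace by metis
  have "trace (lie X Y) = 0" using lie_in_sl[of X Y] by (simp add: sl_def)
  then show ?thesis
    using kks_form_fundamental[OF X'(1) Y'(1), of y] by (simp add: X' Y' killing_eq_trace)
qed

lemma orbit_tangent_eq_range: "orbit_tangent y = range (\<lambda>X. lie X y)"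
proof
  show "range (\<lambda>X. lie X y) \<subseteq> orbit_tangent y"
  proof (clarsimp simp: orbit_tangent_def)
    fix X
    obtain X' where "X' \<in> sl" "lie X' y = lie X y" using lie_remove_trace[of X] by metis
    then show "lie X y \<in> (\<lambda>X. lie X y) ` sl" by (metis image_eqI)
  qed
qed (auto simp: orbit_tangent_def)

lemma trace_mult_lie: "trace (y ** lie X Y) = trace (lie y X ** Y)"
proof -
  have "trace (y ** Y ** X) = trace (X ** y ** Y)"
    using trace_mul_sym[of "y ** Y" X] by (simp add: matrix_mul_assoc)
  then show ?thesis
    by (simp add: lie_def matrix_ring_simps trace_linear_simps matrix_mul_assoc)
qed

text \<open>Testing against the transpose gives the squared Euclidean norm.\<close>

lemma trace_form_nondegenerate:
  fixes A :: "real^'n^'n"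
  assumes "\<And>B. trace (A ** B) = 0"
  shows "A = 0"
proof -
  have "trace (A ** transpose A) = A \<bullet> A"
    by (simp add: trace_def matrix_matrix_mult_def transpose_def inner_vec_def)
  then show ?thesis using assms by simp
qed

section \<open>Dilations of nilpotent matrices\<close>

lemma span_Int_disjoint_independent:
  fixes A B :: "'a::real_vector set"
  assumes "independent (A \<union> B)" "A \<inter> B = {}" "v \<in> span A" "v \<in> span B"
  shows "v = 0"
proof -
  have "representation (A \<union> B) v = representation A v" "representation (A \<union> B) v = representation B v"
    using assms by (auto intro!: representation_extend)
  then have "representation A v b = 0" for b
    using representation_ne_zero[of A v b] representation_ne_zero[of B v b] assms(2) by fastforce
  then show ?thesis
    using sum_nonzero_representation_eq[OF independent_mono[OF assms(1)] assms(3)] by simp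
qed

text \<open>A twisted-commuting automorphism of the image of \<open>V\<close> extends to \<open>V\<close>: on a complement of
  \<open>f ` V\<close> within \<open>f ` V + ker f\<close> take the identity, and on further basis vectors choose preimages.\<close>

lemma twisted_commuting_extend:
  fixes f h :: "'a::euclidean_space \<Rightarrow> 'a"
  assumes f: "linear f" and V: "subspace V" "f ` V \<subseteq> V" and c: "c \<noteq> 0"
    and h: "linear h" "h ` f ` V \<subseteq> f ` V" "\<And>w. w \<in> f ` V \<Longrightarrow> h w = 0 \<Longrightarrow> w = 0"
      "\<And>w. w \<in> f ` V \<Longrightarrow> h (f w) = c *\<^sub>R f (h w)"
  shows "\<exists>g. linear g \<and> g ` V \<subseteq> V \<and> (\<forall>v\<in>V. g v = 0 \<longrightarrow> v = 0) \<and> (\<forall>v\<in>V. g (f v) = c *\<^sub>R f (g v))"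
proof -
  define W where "W = f ` V"
  have W: "subspace W" "W \<subseteq> V" using V f by (auto simp: W_def linear_subspace_image)
  have hW: "h ` W \<subseteq> W" using h(2) by (simp add: W_def)
  define K where "K = {v \<in> V. f v = 0}"
  obtain A where A: "independent A" "A \<subseteq> W" "span A = W"
    using W(1) by (metis basis_exists span_subspace)
  obtain B where B: "A \<subseteq> B" "B \<subseteq> A \<union> K" "independent B" "A \<union> K \<subseteq> span B"
    using maximal_independent_subset_extend[of A "A \<union> K"] A by blast
  have KV: "K \<subseteq> V" by (auto simp: K_def)
  have BV: "B \<subseteq> V" using B(2) A(2) W(2) KV by auto
  obtain C where C: "B \<subseteq> C" "C \<subseteq> V" "independent C" "V \<subseteq> span C"
    using maximal_independent_subset_extend[OF BV B(3)] by metis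
  \<comment> \<open>Twisted commutation at \<open>b\<close> prescribes \<open>f (g b)\<close>; the
    prescribed value lies in the image of \<open>V\<close>, so it has a preimage to serve as
    \<open>g b\<close>.\<close>
  have "\<exists>u\<in>V. f u = (1 / c) *\<^sub>R h (f b)" if "b \<in> V" for b
  proof -
    have "(1 / c) *\<^sub>R h (f b) \<in> W"
      using that h(2) by (intro subspace_scale[OF W(1)]) (auto simp: W_def)
    then show ?thesis by (auto simp: W_def)
  qed
  then obtain p where p: "\<And>b. b \<in> V \<Longrightarrow> p b \<in> V" "\<And>b. b \<in> V \<Longrightarrow> f (p b) = (1 / c) *\<^sub>R h (f b)"
    by metis
  obtain g where g: "linear g"
    and gC: "\<And>b. b \<in> C \<Longrightarrow> g b = (if b \<in> A then h b else if b \<in> B then b else p b)"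
    using linear_independent_extend[OF C(3), of "\<lambda>b. if b \<in> A then h b else if b \<in> B then b else p b"]
    by blast
  have gA: "g b = h b" if "b \<in> A" for b using that gC B C by auto
  have gW: "g w = h w" if "w \<in> W" for w
    using linear_eq_on_span[OF g h(1), of A w] gA that A(3) by auto
  have gB: "g b = b" if "b \<in> B - A" for b using that gC C by auto
  have spanC: "span C = V"
    using C V(1) by (metis span_minimal subset_antisym)
  have "g b \<in> V" if "b \<in> C" for b
  proof (cases "b \<in> A")
    case True
    then have "h b \<in> W" using A(2) hW by blast
    then show ?thesis using gA[OF True] W(2) by auto
  next
    case False
    have "b \<in> V" using that C(2) by blast
    then show ?thesis using gC[OF that] False p(1) by simp
  qed
  then have "g ` C \<subseteq> V" by blast
  then have "span (g ` C) \<subseteq> V" by (rule span_minimal) (rule V(1))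
  then have gV: "g ` V \<subseteq> V" by (metis linear_span_image g spanC)
  have comm: "g (f v) = c *\<^sub>R f (g v)" if "v \<in> V" for v
  proof -
    have lin: "linear (\<lambda>v. g (f v))" "linear (\<lambda>v. c *\<^sub>R f (g v))"
      using linear_compose[OF f g] linear_compose_scale_right[OF linear_compose[OF g f], of c]
      by (auto simp: o_def)
    have "g (f b) = c *\<^sub>R f (g b)" if b: "b \<in> C" for b
    proof -
      have fb: "g (f b) = h (f b)" using b C(2) by (intro gW) (auto simp: W_def)
      consider "b \<in> A" | "b \<in> B - A" | "b \<notin> B" by blast
      then show ?thesis
      proof cases
        case 1
        then show ?thesis using fb gA h(4) A(2) by (auto simp: W_def)
      next
        case 2
        then have "f b = 0" using B(2) by (auto simp: K_def)
        then show ?thesis using gB[OF 2] linear_0[OF g] by simp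
      next
        case 3
        then show ?thesis using fb gC[OF b] p(2)[of b] c b B(1) C(2) by auto
      qed
    qed
    then show ?thesis using linear_eq_on_span[OF lin, of C v] that spanC by blast
  qed
  have inj: "v = 0" if v: "v \<in> V" "g v = 0" for v
  proof -
    \<comment> \<open>Injectivity on the image first forces \<open>f v = 0\<close>. Then
      \<open>v\<close> splits into a part in \<open>W\<close>, where \<open>g\<close> is
      \<open>h\<close>, and a part in the complement, where \<open>g\<close> is the identity;
      independence makes both parts vanish.\<close>
    have "h (f v) = 0"
      using comm[OF v(1)] gW[of "f v"] v linear_0[OF f] by (auto simp: W_def)
    then have "f v = 0" using h(3) v(1) by blast
    then have "v \<in> span (A \<union> (B - A))" using v(1) B(1,4) by (auto simp: K_def Un_absorb1)
    then obtain w u where wu: "w \<in> span A" "u \<in> span (B - A)" "v = w + u"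
      unfolding span_Un by blast
    have gu: "g u = u"
      using linear_eq_on_span[OF g linear_id, of "B - A" u] gB wu(2) by auto
    have w: "w \<in> W" using wu(1) A(3) by simp
    have "h w + u = 0" using v(2) wu(3) gu gW[OF w] linear_add[OF g] by simp
    then have u: "u = - h w" by (simp add: add_eq_0_iff)
    have "h w \<in> W" using h(2) w by (auto simp: W_def)
    then have "u \<in> span A" using u A(3) W(1) by (simp add: subspace_neg)
    then have "u = 0"
      using span_Int_disjoint_independent[of A "B - A" u] wu(2) B(1,3) by (auto simp: Un_absorb1)
    then show ?thesis using u h(3)[of w] w wu(3) by (auto simp: W_def)
  qed
  show ?thesis using g gV inj comm by blast
qed

text \<open>Induction down the chain of iterated images of \<open>V\<close>, extending the
  automorphism by one stage each time. It shows that a nilpotent map is conjugate to each of its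
  nonzero multiples without using Jordan forms.\<close>

lemma nilpotent_twisted_commuting:
  fixes f :: "'a::euclidean_space \<Rightarrow> 'a"
  assumes f: "linear f" and c: "c \<noteq> 0"
    and "subspace V" "f ` V \<subseteq> V" "\<And>v. v \<in> V \<Longrightarrow> (f ^^ m) v = 0"
  shows "\<exists>g. linear g \<and> g ` V \<subseteq> V \<and> (\<forall>v\<in>V. g v = 0 \<longrightarrow> v = 0) \<and> (\<forall>v\<in>V. g (f v) = c *\<^sub>R f (g v))"
  using assms(3-)
proof (induction m arbitrary: V)
  case 0
  then have zero: "v = 0" if "v \<in> V" for v using that by simp
  then have "id (f v) = c *\<^sub>R f (id v)" if "v \<in> V" for v
    using zero[OF that] linear_0[OF f] by simp
  moreover have "linear (id :: 'a \<Rightarrow> 'a)" by (rule linear_id)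
  ultimately show ?case using zero by (intro exI[of _ id]) (metis id_apply image_id order_refl)
next
  case (Suc m)
  have "\<exists>g. linear g \<and> g ` f ` V \<subseteq> f ` V \<and> (\<forall>v\<in>f ` V. g v = 0 \<longrightarrow> v = 0)
      \<and> (\<forall>v\<in>f ` V. g (f v) = c *\<^sub>R f (g v))"
    using Suc.prems by (intro Suc.IH) (auto simp: linear_subspace_image f funpow_swap1)
  then obtain g where g: "linear g" "g ` f ` V \<subseteq> f ` V" "\<forall>v\<in>f ` V. g v = 0 \<longrightarrow> v = 0"
      "\<forall>v\<in>f ` V. g (f v) = c *\<^sub>R f (g v)" by (elim exE conjE)
  show ?case
    by (rule twisted_commuting_extend[OF f Suc.prems(1,2) c g(1,2)]) (use g(3,4) in auto)
qed

lemma matpow_mult_vector: "matpow x k *v v = (((*v) x) ^^ k) v"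
proof (induction k arbitrary: v)
  case (Suc k)
  have "matpow x (Suc k) = x ** matpow x k" by (simp add: matpow_def)
  then show ?case by (simp add: Suc.IH flip: matrix_vector_mul_assoc)
qed (simp add: matpow_def)

text \<open>An automorphism realising the factor 2 may have negative determinant. Its square has
  positive determinant and realises the factor 4.\<close>

lemma nilpotent_mat_dilation:
  fixes x :: "real^'n^'n"
  assumes "nilpotent_mat x"
  obtains h :: "real^'n^'n" where "det h > 0" "h ** x = 4 *\<^sub>R (x ** h)"
proof -
  obtain k where "matpow x k = 0" using assms by (auto simp: nilpotent_mat_def)
  then have "(((*v) x) ^^ k) v = 0" for v by (simp flip: matpow_mult_vector)
  then obtain g where g: "linear g" "\<And>v. g v = 0 \<Longrightarrow> v = 0" "\<And>v. g (x *v v) = 2 *\<^sub>R (x *v g v)"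
    using nilpotent_twisted_commuting[of "(*v) x" 2 UNIV k] by auto
  define G where "G = matrix g"
  have G: "G *v v = g v" for v using g(1) by (simp add: G_def matrix_works)
  have "inj g" using g by (simp add: linear_injective_0)
  then have "det G \<noteq> 0" using det_nz_iff_inj[OF g(1)] by (simp add: G_def)
  then have "det (G ** G) > 0" by (simp add: det_mul) (metis not_real_square_gt_zero)
  moreover have comm: "G *v (x *v v) = 2 *\<^sub>R (x *v (G *v v))" for v
    using g(3) by (simp add: G)
  have "(G ** G) ** x = 4 *\<^sub>R (x ** (G ** G))"
    by (subst matrix_eq)
      (simp add: matrix_vector_mul_assoc[symmetric] comm matrix_vector_mult_scaleR scaleR_matrix_vector_assoc[symmetric])
  ultimately show ?thesis using that by blast
qed

section \<open>Directions of negative energy\<close>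

lemma matrix_inv_unique:
  fixes g h :: "real^'n^'n"
  assumes "g ** h = mat 1"
  shows "matrix_inv g = h"
proof -
  have "det g \<noteq> 0" using assms by (metis det_I det_mul mult_zero_left zero_neq_one)
  then have "matrix_inv g ** g = mat 1" by (rule mult_matrix_inv)
  then show ?thesis using assms by (metis matrix_mul_assoc matrix_mul_lid matrix_mul_rid)
qed

lemma det_scaleR_matrix:
  fixes A :: "real^'n^'n"
  shows "det (c *\<^sub>R A) = c ^ CARD('n) * det A"
  by (simp add: det_def prod.distrib sum_distrib_left mult.left_commute)

text \<open>A positive scalar normalises the determinant to 1 and cancels in the conjugation, so
  positivity of the determinant suffices.\<close>

lemma adjoint_orbit_conj:
  fixes x y g h :: "real^'n^'n"
  assumes y: "y \<in> adjoint_orbit x" and g: "det g > 0" "g ** h = mat 1"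
  shows "g ** y ** h \<in> adjoint_orbit x"
proof -
  obtain k where k: "det k = 1" "y = k ** x ** matrix_inv k"
    using y by (auto simp: adjoint_orbit_def)
  have kk: "k ** matrix_inv k = mat 1" using k(1) mult_matrix_inv by force
  define c where "c = root CARD('n) (1 / det g)"
  have c: "c > 0" "c ^ CARD('n) * det g = 1"
    using g(1) by (simp_all add: c_def real_root_gt_zero real_root_pow_pos)
  have "matrix_inv (c *\<^sub>R (g ** k)) = (1 / c) *\<^sub>R (matrix_inv k ** h)"
  proof (rule matrix_inv_unique)
    have "g ** k ** matrix_inv k ** h = mat 1"
      using kk g(2) by (metis matrix_mul_assoc matrix_mul_rid)
    then show "c *\<^sub>R (g ** k) ** (1 / c) *\<^sub>R (matrix_inv k ** h) = mat 1"
      using c(1) by (simp add: matrix_ring_simps matrix_mul_assoc)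
  qed
  then have "g ** y ** h = c *\<^sub>R (g ** k) ** x ** matrix_inv (c *\<^sub>R (g ** k))"
    using c(1) by (simp add: k(2) matrix_ring_simps matrix_mul_assoc)
  moreover have "det (c *\<^sub>R (g ** k)) = 1"
    using c(2) k(1) by (simp add: det_scaleR_matrix det_mul)
  ultimately show ?thesis unfolding adjoint_orbit_def by blast
qed

lemma adjoint_orbit_self:
  fixes x :: "real^'n^'n"
  shows "x \<in> adjoint_orbit x"
proof -
  have "matrix_inv (mat 1 :: real^'n^'n) = mat 1"
    by (rule matrix_inv_unique) simp
  then show ?thesis
    unfolding adjoint_orbit_def by (intro CollectI exI[of _ "mat 1"]) simp
qed

text \<open>Iterating the conjugation that multiplies \<open>x\<close> by 4 handles \<open>x\<close>
  itself, and conjugation commutes with scaling. Powers of 4 are unbounded, which is all that the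
  divergence requires.\<close>

lemma nilpotent_orbit_dilation:
  fixes x y :: "real^'n^'n"
  assumes x: "nilpotent_mat x" and y: "y \<in> adjoint_orbit x"
  shows "4 ^ m *\<^sub>R y \<in> adjoint_orbit x"
proof -
  obtain h where h: "det h > 0" "h ** x = 4 *\<^sub>R (x ** h)" using nilpotent_mat_dilation[OF x] .
  have hh: "h ** matrix_inv h = mat 1" using h(1) mult_matrix_inv by force
  have "h ** x ** matrix_inv h = 4 *\<^sub>R (x ** (h ** matrix_inv h))"
    by (simp only: h(2) matrix_ring_simps matrix_mul_assoc)
  then have conj: "h ** x ** matrix_inv h = 4 *\<^sub>R x" by (simp add: hh)
  have "4 ^ m *\<^sub>R x \<in> adjoint_orbit x"
  proof (induction m)
    case (Suc m)
    have "h ** (4 ^ m *\<^sub>R x) ** matrix_inv h \<in> adjoint_orbit x"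
      using Suc.IH h(1) hh by (rule adjoint_orbit_conj)
    then show ?case by (simp add: matrix_ring_simps conj mult.commute)
  qed (simp add: adjoint_orbit_self)
  moreover obtain k where k: "det k = 1" "y = k ** x ** matrix_inv k"
    using y by (auto simp: adjoint_orbit_def)
  moreover have "k ** matrix_inv k = mat 1" using k(1) mult_matrix_inv by force
  ultimately have "k ** (4 ^ m *\<^sub>R x) ** matrix_inv k \<in> adjoint_orbit x"
    by (intro adjoint_orbit_conj) auto
  then show ?thesis by (simp add: k(2) matrix_ring_simps)
qed

lemma matrix_with_columns:
  fixes a b :: "real^'n"
  assumes ij: "i \<noteq> j" and ab: "a \<noteq> b" "independent {a, b}"
  obtains A :: "real^'n^'n" where "det A \<noteq> 0" "A *v axis i 1 = a" "A *v axis j 1 = b"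
proof -
  obtain B where B: "{a, b} \<subseteq> B" "independent B" "UNIV \<subseteq> span B"
    using maximal_independent_subset_extend[of "{a, b}" UNIV] ab by auto
  have finB: "finite B" using B(2) by (rule independent_imp_finite)
  have cardB: "card B = CARD('n)"
    using B(2,3) basis_card_eq_dim[of B UNIV] by simp
  have "card (UNIV - {i, j}) = card (B - {a, b})"
    using ij ab(1) B(1) finB cardB by (simp add: card_Diff_subset)
  then obtain \<pi> where \<pi>: "bij_betw \<pi> (UNIV - {i, j}) (B - {a, b})"
    using finite_same_card_bij finB by (metis finite finite_Diff)
  define \<rho> where "\<rho> k = (if k = i then a else if k = j then b else \<pi> k)" for k
  have img: "\<rho> ` UNIV = B"
  proof -
    have "\<rho> ` UNIV = \<rho> ` (UNIV - {i, j}) \<union> \<rho> ` {i, j}" by auto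
    also have "\<rho> ` (UNIV - {i, j}) = \<pi> ` (UNIV - {i, j})" by (rule image_cong) (auto simp: \<rho>_def)
    also have "\<dots> = B - {a, b}" using \<pi> by (simp add: bij_betw_def)
    also have "\<rho> ` {i, j} = {a, b}" using ij by (auto simp: \<rho>_def)
    finally show ?thesis using B(1) by auto
  qed
  define A :: "real^'n^'n" where "A = (\<chi> r s. \<rho> s $ r)"
  have col: "A *v axis k 1 = \<rho> k" for k
    by (simp add: A_def matrix_vector_mult_basis column_def)
  have "B \<subseteq> range ((*v) A)"
    using img col by (metis image_subset_iff rangeI)
  then have "span B \<subseteq> range ((*v) A)"
    by (rule span_minimal) (simp add: linear_subspace_image)
  then have "surj ((*v) A)" using B(3) by auto
  then obtain A' where "A ** A' = mat 1"
    using matrix_right_invertible_surjective[of A] by blast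
  then have "det A \<noteq> 0" by (metis det_I det_mul mult_zero_left zero_neq_one)
  moreover have "A *v axis i 1 = a" "A *v axis j 1 = b" using ij by (auto simp: col \<rho>_def)
  ultimately show ?thesis using that by blast
qed

text \<open>Both pairs are completed to bases. A third basis direction, outside the prescribed pair,
  absorbs the sign of the determinant.\<close>

lemma positive_det_transport:
  fixes a b p q :: "real^'n"
  assumes n: "CARD('n) \<ge> 3" and ab: "a \<noteq> b" "independent {a, b}" and pq: "p \<noteq> q" "independent {p, q}"
  obtains g :: "real^'n^'n" where "det g > 0" "g *v a = p" "g *v b = q"
proof -
  obtain i j k :: 'n where ijk: "i \<noteq> j" "k \<noteq> i" "k \<noteq> j"
  proof -
    obtain S :: "'n set" where "card S = 3" using obtain_subset_with_card_n[OF n] by auto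
    then show ?thesis using that by (auto simp: card_3_iff)
  qed
  obtain A where A: "det A \<noteq> 0" "A *v axis i 1 = a" "A *v axis j 1 = b"
    using matrix_with_columns[OF ijk(1) ab] .
  obtain P where P: "det P \<noteq> 0" "P *v axis i 1 = p" "P *v axis j 1 = q"
    using matrix_with_columns[OF ijk(1) pq] .
  \<comment> \<open>With this sign on the diagonal entry \<open>k\<close> of \<open>D\<close>, the
    determinant of \<open>g\<close> becomes the absolute value of
    \<open>det P / det A\<close>.\<close>
  define s where "s = sgn (det P / det A)"
  define D :: "real^'n^'n" where "D = (\<chi> r c. if r = c then (if r = k then s else 1) else 0)"
  have "det D = (\<Prod>r\<in>UNIV. if r = k then s else 1)"
    by (subst det_diagonal) (auto simp: D_def)
  then have detD: "det D = s" by simp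
  have D: "D *v axis i 1 = axis i 1" "D *v axis j 1 = axis j 1"
    using ijk by (simp_all add: matrix_vector_mult_basis) (auto simp: D_def column_def axis_def vec_eq_iff)
  have inv: "matrix_inv A ** A = mat 1" using A(1) by (rule mult_matrix_inv)
  define g where "g = P ** D ** matrix_inv A"
  have "det (matrix_inv A) * det A = 1" using inv by (metis det_I det_mul)
  then have "det g = \<bar>det P / det A\<bar>"
    using A(1) by (simp add: g_def det_mul detD s_def field_simps abs_mult_sgn abs_sgn)
  then have "det g > 0" using A(1) P(1) by simp
  moreover have "matrix_inv A *v a = axis i 1" "matrix_inv A *v b = axis j 1"
    using inv A(2,3) by (metis matrix_vector_mul_assoc matrix_vector_mul_lid)+
  then have "g *v a = p" "g *v b = q"
    by (simp_all add: g_def D P flip: matrix_vector_mul_assoc)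
  ultimately show ?thesis using that by blast
qed

text \<open>If every vector were an eigenvector, comparing eigenvalues on sums of two standard basis
  vectors would make the matrix scalar, and trace zero would make it 0.\<close>

lemma not_scalar_imp_not_eigenvector:
  fixes \<beta> :: "real^'n^'n"
  assumes "\<beta> \<in> sl" "\<beta> \<noteq> 0"
  obtains p where "\<beta> *v p \<notin> span {p}"
proof (rule ccontr)
  assume "\<not> thesis"
  then have "\<exists>c. \<beta> *v p = c *\<^sub>R p" for p using that by (fastforce simp: span_singleton)
  then obtain c where c: "\<And>p. \<beta> *v p = c p *\<^sub>R p" by metis
  have const: "c (axis i 1) = c (axis j 1)" for i j :: 'n
  proof (cases "i = j")
    case False
    let ?p = "axis i 1 + axis j 1 :: real^'n"
    have eq: "c ?p *\<^sub>R ?p = c (axis i 1) *\<^sub>R axis i 1 + c (axis j 1) *\<^sub>R axis j 1"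
      using c[of ?p] c[of "axis i 1"] c[of "axis j 1"] by (simp add: matrix_vector_right_distrib)
    show ?thesis
      using arg_cong[OF eq, of "\<lambda>v. v $ i"] arg_cong[OF eq, of "\<lambda>v. v $ j"] False by (simp add: axis_def)
  qed simp
  define d where "d = c (axis undefined 1)"
  have entry: "\<beta> $ r $ s = (if r = s then d else 0)" for r s
  proof -
    have "\<beta> $ r $ s = (\<beta> *v axis s 1) $ r" by (simp add: matrix_vector_mult_basis column_def)
    also have "\<dots> = (if r = s then d else 0)"
      using const[of s undefined] by (simp add: c d_def axis_def)
    finally show ?thesis .
  qed
  have "trace \<beta> = CARD('n) * d" by (simp add: trace_def entry)
  then have "d = 0" using assms(1) by (simp add: sl_def)
  then have "\<beta> = 0" by (simp add: vec_eq_iff entry)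
  then show False using assms(2) by simp
qed

text \<open>A vector \<open>u\<close> with \<open>x (x u) \<noteq> 0\<close> and
  \<open>x (x (x u)) = 0\<close> generates three independent vectors, which also bounds the
  dimension from below.\<close>

lemma cyclic_vector_of_index_gt_2:
  fixes x :: "real^'n^'n"
  assumes "nilpotent_mat x" "nilpotency_index x > 2"
  obtains u where "x *v u \<noteq> u" "independent {u, x *v u}" "CARD('n) \<ge> 3"
proof -
  define N where "N = nilpotency_index x"
  have N: "N > 2" "matpow x N = 0" "matpow x (N - 1) \<noteq> 0"
    using assms not_less_Least[of "N - 1" "\<lambda>k. matpow x k = 0"]
    by (auto simp: N_def nilpotency_index_def nilpotent_mat_def intro: LeastI)
  then obtain v where v: "matpow x (N - 1) *v v \<noteq> 0"
    by (metis matrix_eq matrix_vector_mult_0)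
  \<comment> \<open>With \<open>N\<close> the nilpotency index, exactly two further applications of
    \<open>x\<close> reach the nonzero vector given by power \<open>N - 1\<close>.\<close>
  define u where "u = matpow x (N - 3) *v v"
  have pow: "(((*v) x) ^^ k) u = matpow x (k + (N - 3)) *v v" for k
    by (simp add: u_def matpow_mult_vector funpow_add)
  have 2: "x *v (x *v u) \<noteq> 0"
  proof -
    have "Suc (Suc (N - 3)) = N - 1" using N(1) by simp
    then show ?thesis using pow[of 2] v by (simp add: numeral_2_eq_2)
  qed
  have 3: "x *v (x *v (x *v u)) = 0"
  proof -
    have "3 + (N - 3) = N" using N(1) by simp
    then have "(((*v) x) ^^ 3) u = 0" using pow[of 3] N(2) by simp
    then show ?thesis by (simp add: numeral_3_eq_3)
  qed
  let ?a = "x *v (x *v u)" and ?b = "x *v u"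
  have b: "?b \<notin> span {?a}"
  proof
    assume "?b \<in> span {?a}"
    then obtain c where "?b = c *\<^sub>R ?a" by (auto simp: span_singleton)
    from arg_cong[OF this, of "(*v) x"] have "x *v ?b = 0" using 3 by (simp add: matrix_vector_mult_scaleR)
    then show False using 2 by simp
  qed
  have u: "u \<notin> span {?b, ?a}"
  proof
    assume "u \<in> span {?b, ?a}"
    then obtain c d where "u = c *\<^sub>R ?b + d *\<^sub>R ?a"
    proof -
      obtain c where "u - c *\<^sub>R ?b \<in> span {?a}" using \<open>u \<in> _\<close> by (auto simp: span_insert)
      then obtain d where "u - c *\<^sub>R ?b = d *\<^sub>R ?a" by (auto simp: span_singleton)
      then show ?thesis using that[of c d] by (simp add: diff_eq_eq add.commute)
    qed
    then have "x *v (x *v u) = x *v (x *v (c *\<^sub>R ?b + d *\<^sub>R ?a))" by (rule arg_cong)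
    also have "\<dots> = 0"
      using 3 by (simp add: matrix_vector_right_distrib matrix_vector_mult_scaleR)
    finally show False using 2 by simp
  qed
  have ne: "u \<noteq> ?b" "u \<noteq> ?a" "?b \<noteq> ?a" using u b by (auto intro: span_base)
  have ind: "independent {u, ?b, ?a}"
    using u b 2 ne by (simp add: independent_insert)
  have "card {u, ?b, ?a} \<le> DIM(real^'n)" using independent_bound[OF ind] by simp
  then have "CARD('n) \<ge> 3" using ne by simp
  moreover have "independent {u, ?b}" using independent_mono[OF ind] by auto
  ultimately show ?thesis using that ne(1) by metis
qed

lemma trace_outer_product:
  fixes p w :: "real^'n"
  shows "trace ((\<chi> i j. p $ i * w $ j) ** M) = w \<bullet> (M *v p)"
  by (simp add: trace_def matrix_matrix_mult_def matrix_vector_mult_def inner_vec_def sum_distrib_left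
      mult_ac) (subst sum.swap, simp add: mult_ac)

lemma outer_product_mult_vector:
  fixes p w :: "real^'n"
  shows "(\<chi> i j. p $ i * w $ j) *v v = (w \<bullet> v) *\<^sub>R p"
  by (simp add: matrix_vector_mult_def inner_vec_def vec_eq_iff sum_distrib_left sum_distrib_right mult_ac)

text \<open>Conjugating by \<open>1 + t N\<close> with \<open>N = p w\<^sup>T\<close> nilpotent changes \<open>trace (y \<beta>)\<close> by a quadratic
  polynomial in \<open>t\<close> with leading coefficient \<open>- (w \<bullet> y p) (w \<bullet> \<beta> p)\<close>.\<close>

lemma orbit_negative_direction:
  fixes x \<beta> :: "real^'n^'n"
  assumes x: "nilpotent_mat x" "nilpotency_index x > 2" and \<beta>: "\<beta> \<in> sl" "\<beta> \<noteq> 0"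
  obtains y where "y \<in> adjoint_orbit x" "trace (y ** \<beta>) < 0"
proof -
  obtain u where u: "x *v u \<noteq> u" "independent {u, x *v u}" and n: "CARD('n) \<ge> 3"
    using cyclic_vector_of_index_gt_2[OF x] .
  obtain p where p: "\<beta> *v p \<notin> span {p}" using not_scalar_imp_not_eigenvector[OF \<beta>] .
  have p0: "p \<noteq> 0" and "p \<noteq> \<beta> *v p" using p span_base[of p "{p}"] by (auto simp: span_zero)
  moreover have "independent {p, \<beta> *v p}"
    using p p0 by (subst insert_commute) (simp add: independent_insert)
  ultimately obtain g where g: "det g > 0" "g *v u = p" "g *v (x *v u) = \<beta> *v p"
    using positive_det_transport[OF n _ u(2)] u(1) by metis
  have gg: "g ** matrix_inv g = mat 1" "matrix_inv g ** g = mat 1"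
    using g(1) mult_matrix_inv[of g] by auto
  define y where "y = g ** x ** matrix_inv g"
  have y: "y \<in> adjoint_orbit x"
    unfolding y_def by (rule adjoint_orbit_conj[OF adjoint_orbit_self g(1) gg(1)])
  have "matrix_inv g *v p = u"
    using gg(2) g(2) by (metis matrix_vector_mul_assoc matrix_vector_mul_lid)
  then have yp: "y *v p = \<beta> *v p"
    by (simp add: y_def g(3) flip: matrix_vector_mul_assoc)
  \<comment> \<open>The component of \<open>\<beta> *v p\<close> orthogonal to \<open>p\<close>,
    nonzero because \<open>p\<close> is not an eigenvector. Orthogonality gives
    \<open>N ** N = 0\<close>, and \<open>w \<bullet> (\<beta> *v p)\<close> is the squared norm of
    \<open>w\<close>.\<close>
  define w where "w = \<beta> *v p - ((p \<bullet> (\<beta> *v p)) / (p \<bullet> p)) *\<^sub>R p"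
  have wp: "w \<bullet> p = 0" using p0 by (simp add: w_def inner_diff_left inner_commute[of "\<beta> *v p" p])
  have "w \<noteq> 0" using p by (auto simp: w_def span_singleton)
  have "\<beta> *v p = w + ((p \<bullet> (\<beta> *v p)) / (p \<bullet> p)) *\<^sub>R p" by (simp add: w_def)
  from arg_cong[OF this, of "inner w"] have "w \<bullet> (\<beta> *v p) = w \<bullet> w"
    using wp by (simp add: inner_add_right)
  then have wb: "w \<bullet> (\<beta> *v p) > 0" using \<open>w \<noteq> 0\<close> by simp
  define N :: "real^'n^'n" where "N = (\<chi> i j. p $ i * w $ j)"
  have Nv: "N *v v = (w \<bullet> v) *\<^sub>R p" for v by (simp add: N_def outer_product_mult_vector)
  have NN: "N ** N = 0"
    by (subst matrix_eq) (simp add: Nv wp flip: matrix_vector_mul_assoc)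
  define a where "a = trace (y ** \<beta>)"
  define b where "b = trace ((N ** y - y ** N) ** \<beta>)"
  define e where "e = (w \<bullet> (\<beta> *v p))\<^sup>2"
  have e: "e > 0" using wb by (simp add: e_def)
  have NyN: "N ** y ** N = (w \<bullet> (y *v p)) *\<^sub>R N"
    by (subst matrix_eq) (simp add: Nv matrix_vector_mult_scaleR inner_scaleR_right
      scaleR_matrix_vector_assoc[symmetric] flip: matrix_vector_mul_assoc)
  \<comment> \<open>Here \<open>y *v p = \<beta> *v p\<close> makes the two factors of the quadratic
    coefficient equal, so that it is a positive square.\<close>
  have quad: "trace (N ** y ** N ** \<beta>) = e"
    by (simp add: NyN yp matrix_ring_simps trace_linear_simps e_def power2_eq_square)
      (simp add: N_def trace_outer_product)
  have orb: "(mat 1 + t *\<^sub>R N) ** y ** (mat 1 - t *\<^sub>R N) \<in> adjoint_orbit x" for t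
  proof (rule adjoint_orbit_conj[OF y])
    \<comment> \<open>Since \<open>N\<close> squares to 0, \<open>1 + t N\<close> is the square of
      \<open>1 + (t / 2) N\<close>, so its determinant is positive.\<close>
    have half: "(mat 1 + s *\<^sub>R N) ** (mat 1 + s *\<^sub>R N) = mat 1 + (2 * s) *\<^sub>R N"
      and cancel: "(mat 1 + s *\<^sub>R N) ** (mat 1 - s *\<^sub>R N) = mat 1" for s
      by (simp_all add: matrix_ring_simps NN scaleR_2 flip: scaleR_scaleR)
    show "(mat 1 + t *\<^sub>R N) ** (mat 1 - t *\<^sub>R N) = mat 1" by (rule cancel)
    have "det (mat 1 + (t / 2) *\<^sub>R N) \<noteq> 0"
      using cancel by (metis det_I det_mul mult_zero_left zero_neq_one)
    then show "det (mat 1 + t *\<^sub>R N) > 0"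
      using arg_cong[OF half[of "t / 2"], of det] by (simp add: det_mul) (metis not_real_square_gt_zero)
  qed
  have val: "trace ((mat 1 + t *\<^sub>R N) ** y ** (mat 1 - t *\<^sub>R N) ** \<beta>) = a + t * b - t * t * e" for t
  proof -
    have "(mat 1 + t *\<^sub>R N) ** y ** (mat 1 - t *\<^sub>R N) ** \<beta>
        = y ** \<beta> + t *\<^sub>R ((N ** y - y ** N) ** \<beta>) - (t * t) *\<^sub>R (N ** y ** N ** \<beta>)"
      by (simp add: matrix_ring_simps scaleR_diff_right scaleR_add_right)
    then show ?thesis by (simp add: trace_linear_simps quad a_def b_def)
  qed
  \<comment> \<open>Chosen at least 1 and so large that the quadratic term outweighs the constant
    and linear terms together.\<close>
  define t where "t = (1 + \<bar>a\<bar> + \<bar>b\<bar>) / e + 1"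
  have t: "t \<ge> 1" "t * e \<ge> 1 + \<bar>a\<bar> + \<bar>b\<bar>" using e by (auto simp: t_def field_simps)
  have "t * (1 + \<bar>a\<bar> + \<bar>b\<bar>) \<le> t * (t * e)" using t by (intro mult_left_mono) auto
  moreover have "t * b \<le> t * \<bar>b\<bar>" using t(1) by (intro mult_left_mono) auto
  moreover have "1 * (1 + \<bar>a\<bar>) \<le> t * (1 + \<bar>a\<bar>)" using t(1) by (intro mult_right_mono) auto
  ultimately have "a + t * b - t * t * e < 0" by (simp add: algebra_simps)
  then show ?thesis using that orb val by metis
qed

section \<open>Charts by conjugation\<close>

text \<open>Cramer's rule applied to a standard basis vector; it yields continuity of the inverse
  from that of determinants.\<close>

lemma matrix_inv_entry:
  fixes A :: "real^'n^'n"
  assumes "det A \<noteq> 0"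
  shows "matrix_inv A $ i $ j = det (\<chi> r s. if s = i then axis j 1 $ r else A $ r $ s) / det A"
proof -
  have "A *v (matrix_inv A *v axis j 1) = axis j 1"
    using mult_matrix_inv(1)[OF assms] by (simp add: matrix_vector_mul_assoc)
  then have "det (\<chi> r s. if s = i then axis j 1 $ r else A $ r $ s) = (matrix_inv A *v axis j 1) $ i * det A"
    using cramer_lemma[of i A "matrix_inv A *v axis j 1"] by (simp only:)
  then show ?thesis
    using assms by (simp add: matrix_vector_mult_basis column_def)
qed

lemma continuous_on_det:
  fixes f :: "'a::topological_space \<Rightarrow> real^'n^'n"
  assumes "continuous_on S f"
  shows "continuous_on S (\<lambda>x. det (f x))"
  unfolding det_def by (intro continuous_intros assms)

lemma continuous_on_matrix_inv:
  fixes f :: "'a::topological_space \<Rightarrow> real^'n^'n"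
  assumes f: "continuous_on S f" and "\<And>x. x \<in> S \<Longrightarrow> det (f x) \<noteq> 0"
  shows "continuous_on S (\<lambda>x. matrix_inv (f x))"
proof -
  have "continuous_on S (\<lambda>x. \<chi> i j. det (\<chi> r s. if s = i then axis j 1 $ r else f x $ r $ s) / det (f x))"
  proof (intro continuous_on_vec_lambda continuous_on_divide continuous_on_det f)
    show "continuous_on S (\<lambda>x. if s = i then axis j 1 $ r else f x $ r $ s)" for i j r s
      by (cases "s = i") (auto intro!: continuous_intros f)
  qed (use assms(2) in auto)
  then show ?thesis
    by (rule continuous_on_eq) (simp add: assms(2) vec_eq_iff matrix_inv_entry)
qed

lemmas continuous_on_matrix_mult = bounded_bilinear.continuous_on[OF bounded_bilinear_matrix_mult]

lemma continuous_on_trace: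
  fixes f :: "'a::topological_space \<Rightarrow> real^'n^'n"
  assumes "continuous_on S f"
  shows "continuous_on S (\<lambda>x. trace (f x))"
  unfolding trace_def by (intro continuous_intros assms)

lemma continuous_on_lie:
  fixes f g :: "'a::topological_space \<Rightarrow> real^'n^'n"
  assumes "continuous_on S f" "continuous_on S g"
  shows "continuous_on S (\<lambda>x. lie (f x) (g x))"
  unfolding lie_def by (intro continuous_on_diff continuous_on_matrix_mult assms)

lemma has_vector_derivative_iff_quotient:
  "(f has_vector_derivative D) (at a) \<longleftrightarrow> ((\<lambda>s. (1 / (s - a)) *\<^sub>R (f s - f a)) \<longlongrightarrow> D) (at a)"
proof -
  have "(f has_vector_derivative D) (at a)
      \<longleftrightarrow> ((\<lambda>s. (f s - f a - (s - a) *\<^sub>R D) /\<^sub>R norm (s - a)) \<longlongrightarrow> 0) (at a)"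
    by (simp add: has_vector_derivative_def has_derivative_def bounded_linear_scaleR_left Lim_ident_at)
  also have "\<dots> \<longleftrightarrow> ((\<lambda>s. norm ((f s - f a - (s - a) *\<^sub>R D) /\<^sub>R norm (s - a))) \<longlongrightarrow> 0) (at a)"
    by (rule tendsto_norm_zero_iff[symmetric])
  also have "\<dots> \<longleftrightarrow> ((\<lambda>s. norm ((1 / (s - a)) *\<^sub>R (f s - f a) - D)) \<longlongrightarrow> 0) (at a)"
  proof (rule filterlim_cong[OF refl refl])
    have "norm ((f s - f a - (s - a) *\<^sub>R D) /\<^sub>R norm (s - a)) = norm ((1 / (s - a)) *\<^sub>R (f s - f a) - D)"
      if "s \<noteq> a" for s
    proof -
      have "(1 / (s - a)) *\<^sub>R (f s - f a) - D = (1 / (s - a)) *\<^sub>R (f s - f a - (s - a) *\<^sub>R D)"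
        using that by (simp add: scaleR_diff_right)
      then show ?thesis by (simp add: divide_inverse)
    qed
    then show "\<forall>\<^sub>F s in at a. norm ((f s - f a - (s - a) *\<^sub>R D) /\<^sub>R norm (s - a))
        = norm ((1 / (s - a)) *\<^sub>R (f s - f a) - D)"
      by (auto simp: eventually_at_filter)
  qed
  also have "\<dots> \<longleftrightarrow> ((\<lambda>s. (1 / (s - a)) *\<^sub>R (f s - f a)) \<longlongrightarrow> D) (at a)"
    by (simp add: tendsto_norm_zero_iff flip: Lim_null)
  finally show ?thesis .
qed

text \<open>The difference of two inverses equals minus the first inverse times the difference of
  the matrices times the second inverse; divide by \<open>s - a\<close> and pass to the
  limit.\<close>

lemma has_vector_derivative_matrix_inv:
  fixes G :: "real \<Rightarrow> real^'n^'n"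
  assumes G: "(G has_vector_derivative D) (at a)" and det: "det (G a) \<noteq> 0"
  shows "((\<lambda>s. matrix_inv (G s)) has_vector_derivative - (matrix_inv (G a) ** D ** matrix_inv (G a))) (at a)"
proof -
  have cont: "(G \<longlongrightarrow> G a) (at a)"
    using has_vector_derivative_continuous[OF G] by (simp add: continuous_within)
  have "continuous_on {A :: real^'n^'n. det A \<noteq> 0} matrix_inv"
    by (intro continuous_on_matrix_inv continuous_on_id) auto
  moreover have "open {A :: real^'n^'n. det A \<noteq> 0}"
    by (intro open_Collect_neq continuous_on_det continuous_intros)
  ultimately have "isCont matrix_inv (G a)"
    using det by (auto simp: continuous_on_eq_continuous_at)
  then have inv: "((\<lambda>s. matrix_inv (G s)) \<longlongrightarrow> matrix_inv (G a)) (at a)"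
    using cont by (rule isCont_tendsto_compose)
  have "((\<lambda>s. det (G s)) \<longlongrightarrow> det (G a)) (at a)"
    unfolding det_def by (intro tendsto_intros cont)
  then have ev: "\<forall>\<^sub>F s in at a. det (G s) \<noteq> 0"
    using det by (rule tendsto_imp_eventually_ne)
  have "((\<lambda>s. - (matrix_inv (G s) ** ((1 / (s - a)) *\<^sub>R (G s - G a)) ** matrix_inv (G a)))
      \<longlongrightarrow> - (matrix_inv (G a) ** D ** matrix_inv (G a))) (at a)"
    using G by (intro tendsto_minus bounded_bilinear.tendsto[OF bounded_bilinear_matrix_mult] inv tendsto_const)
      (simp add: has_vector_derivative_iff_quotient)
  moreover have "\<forall>\<^sub>F s in at a. - (matrix_inv (G s) ** ((1 / (s - a)) *\<^sub>R (G s - G a)) ** matrix_inv (G a))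
      = (1 / (s - a)) *\<^sub>R (matrix_inv (G s) - matrix_inv (G a))"
    using ev
  proof eventually_elim
    case (elim s)
    have "matrix_inv (G s) ** (G s - G a) ** matrix_inv (G a)
        = (matrix_inv (G s) ** G s) ** matrix_inv (G a) - matrix_inv (G s) ** (G a ** matrix_inv (G a))"
      by (simp add: matrix_ring_simps matrix_mul_assoc)
    also have "\<dots> = matrix_inv (G a) - matrix_inv (G s)"
      using elim det by (simp add: mult_matrix_inv)
    finally show ?case
      by (simp add: matrix_ring_simps(7,8) scaleR_minus_right[symmetric] del: scaleR_minus_right)
  qed
  ultimately show ?thesis
    unfolding has_vector_derivative_iff_quotient by (rule tendsto_cong[THEN iffD1, rotated])
qed

text \<open>The product rule gives a bracket with the logarithmic derivative
  \<open>D ** matrix_inv (G a)\<close>, that is, the value of a fundamental vector field at the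
  moving point.\<close>

lemma has_vector_derivative_conj:
  fixes G :: "real \<Rightarrow> real^'n^'n"
  assumes G: "(G has_vector_derivative D) (at a)" and det: "det (G a) \<noteq> 0"
  shows "((\<lambda>s. G s ** y ** matrix_inv (G s)) has_vector_derivative
    lie (D ** matrix_inv (G a)) (G a ** y ** matrix_inv (G a))) (at a)"
proof -
  note prod = bounded_bilinear.has_vector_derivative[OF bounded_bilinear_matrix_mult]
  have "((\<lambda>s. G s ** y ** matrix_inv (G s)) has_vector_derivative
      (G a ** y) ** - (matrix_inv (G a) ** D ** matrix_inv (G a)) + (G a ** 0 + D ** y) ** matrix_inv (G a)) (at a)"
    by (intro prod G has_vector_derivative_const has_vector_derivative_matrix_inv det)
  moreover have "D ** matrix_inv (G a) ** (G a ** y ** matrix_inv (G a)) = D ** y ** matrix_inv (G a)"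
    using mult_matrix_inv(2)[OF det] by (metis matrix_mul_assoc matrix_mul_rid)
  ultimately show ?thesis
    by (simp add: lie_def matrix_ring_simps matrix_mul_assoc)
qed

section \<open>The orbit form on matrices and frames transversal to the centralizer\<close>

text \<open>The Kirillov-Kostant-Souriau form at \<open>y\<close>, pulled back along
  \<open>X \<mapsto> lie X y\<close> to all matrices. Unlike \<open>kks_form\<close> it is an
  explicit polynomial expression.\<close>

definition orb_form :: "real^'n^'n \<Rightarrow> real^'n^'n \<Rightarrow> real^'n^'n \<Rightarrow> real" where
  "orb_form y X Y = 2 * CARD('n) * trace (y ** lie X Y)"

definition conj_by :: "real^'n^'n \<Rightarrow> real^'n^'n \<Rightarrow> real^'n^'n" where
  "conj_by y A = (mat 1 + A) ** y ** matrix_inv (mat 1 + A)"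

lemma bilinear_orb_form: "bilinear (orb_form y)"
  unfolding bilinear_def
  by (intro conjI allI linearI)
    (simp_all add: orb_form_def matrix_ring_simps trace_linear_simps
      bilinear_ladd[OF bilinear_lie] bilinear_radd[OF bilinear_lie]
      bilinear_lmul[OF bilinear_lie] bilinear_rmul[OF bilinear_lie] distrib_left)

lemma orb_form_self: "orb_form y X X = 0"
  by (simp add: orb_form_def lie_def matrix_ring_simps trace_linear_simps)

text \<open>The radical is the centralizer of \<open>y\<close>: invariance of the trace moves the
  bracket onto \<open>y\<close>, and the trace form is nondegenerate.\<close>

lemma orb_form_radical:
  fixes y :: "real^'n^'n"
  shows "(\<forall>W. orb_form y Z W = 0) \<longleftrightarrow> lie Z y = 0"
proof
  assume "\<forall>W. orb_form y Z W = 0"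
  then have "lie y Z = 0"
    by (intro trace_form_nondegenerate) (simp add: orb_form_def trace_mult_lie)
  then show "lie Z y = 0" using lie_self_neg[of Z y] by simp
next
  assume "lie Z y = 0"
  then have "lie y Z = 0" using lie_self_neg[of Z y] by simp
  then show "\<forall>W. orb_form y Z W = 0"
    by (simp add: orb_form_def trace_mult_lie matrix_ring_simps trace_linear_simps)
qed

lemma kks_form_eq_orb_form: "kks_form y (lie X y) (lie Y y) = orb_form y X Y"
  by (simp add: kks_form_eq_trace orb_form_def)

lemma orb_form_scale: "orb_form (t *\<^sub>R y) X Y = t * orb_form y X Y"
  by (simp add: orb_form_def matrix_ring_simps trace_linear_simps)

text \<open>A symplectic basis \<open>X\<close> of a complement of the centralizer of \<open>y\<close>, with its dual basis.\<close>

locale orbit_frame =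
  fixes y :: "real^'n^'n" and d :: nat and X :: "nat \<Rightarrow> real^'n^'n" and coef :: "nat \<Rightarrow> real^'n^'n \<Rightarrow> real"
  assumes frame: "\<And>i j. i < 2 * d \<Longrightarrow> j < 2 * d \<Longrightarrow> orb_form y (X i) (X j) = std_symp i j"
    and coef_linear: "\<And>i. linear (coef i)"
    and coef_frame: "\<And>i j. i < 2 * d \<Longrightarrow> j < 2 * d \<Longrightarrow> coef i (X j) = (if i = j then 1 else 0)"
    and coef_centralizer: "\<And>i Z. lie Z y = 0 \<Longrightarrow> coef i Z = 0"
    and frame_complement: "\<And>Z. lie (Z - (\<Sum>i<2 * d. coef i Z *\<^sub>R X i)) y = 0"

lemma orbit_frame_exists:
  fixes y :: "real^'n^'n"
  obtains d X coef where "orbit_frame y d X coef"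
proof -
  show ?thesis
  proof (rule symplectic_family_split[OF bilinear_orb_form[of y] orb_form_self[of y]])
    fix d :: nat and X and coef :: "nat \<Rightarrow> real^'n^'n \<Rightarrow> real"
    assume 1: "\<And>i j. i < 2 * d \<Longrightarrow> j < 2 * d \<Longrightarrow> orb_form y (X i) (X j) = std_symp i j"
      and 2: "\<And>i. linear (coef i)"
      and 3: "\<And>i j. i < 2 * d \<Longrightarrow> j < 2 * d \<Longrightarrow> coef i (X j) = (if i = j then 1 else 0)"
      and 4: "\<And>i Z. (\<And>W. orb_form y Z W = 0) \<Longrightarrow> coef i Z = 0"
      and 5: "\<And>Z W. orb_form y (Z - (\<Sum>i<2 * d. coef i Z *\<^sub>R X i)) W = 0"
    have "orbit_frame y d X coef"
    proof (rule orbit_frame.intro)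
      show "coef i Z = 0" if "lie Z y = 0" for i Z
        using that unfolding orb_form_radical[symmetric] by (intro 4) blast
      show "lie (Z - (\<Sum>i<2 * d. coef i Z *\<^sub>R X i)) y = 0" for Z
        unfolding orb_form_radical[symmetric] by (intro allI 5)
    qed (rule 1 2 3; assumption)+
    then show thesis by (rule that)
  qed
qed

context orbit_frame
begin

definition comb :: "(nat \<Rightarrow> real) \<Rightarrow> real^'n^'n" where
  "comb c = (\<Sum>i<2 * d. c i *\<^sub>R X i)"

lemma coef_comb:
  assumes "k < 2 * d"
  shows "coef k (comb c) = c k"
proof -
  have "coef k (comb c) = (\<Sum>i<2 * d. c i * coef k (X i))"
    by (simp add: comb_def linear_sum[OF coef_linear] linear_scale[OF coef_linear])
  also have "\<dots> = (\<Sum>i<2 * d. if i = k then c k else 0)"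
    by (intro sum.cong refl) (auto simp: coef_frame[OF assms])
  finally show ?thesis using assms by (simp add: sum.delta)
qed

lemma lie_comb: "lie (comb c) Z = (\<Sum>i<2 * d. c i *\<^sub>R lie (X i) Z)"
proof -
  have lin: "linear (\<lambda>W. lie W Z)" using bilinear_lie by (auto simp: bilinear_def)
  show ?thesis by (simp add: comb_def linear_sum[OF lin] linear_scale[OF lin])
qed

text \<open>The centralizer is the kernel of \<open>Z \<mapsto> lie Z y\<close>, so this map sends
  the frame of the complement to a basis of the tangent space. Hence \<open>d\<close> is the
  exponent in the Liouville form.\<close>

lemma dim_orbit_tangent: "dim (orbit_tangent y) = 2 * d"
proof -
  let ?v = "\<lambda>i. lie (X i) y"
  have zero: "c k = 0" if "(\<Sum>i<2 * d. c i *\<^sub>R ?v i) = 0" "k < 2 * d" for c k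
    using that coef_centralizer[of "comb c" k] coef_comb[of k c] lie_comb[of c y] by simp
  have lin: "linear (\<lambda>W. lie W y)" using bilinear_lie by (auto simp: bilinear_def)
  have "orbit_tangent y \<subseteq> span (?v ` {..<2 * d})"
  proof (clarsimp simp: orbit_tangent_eq_range)
    fix Z
    have "lie Z y = lie (comb (\<lambda>i. coef i Z)) y"
      using frame_complement[of Z] by (simp add: linear_diff[OF lin] comb_def)
    also have "\<dots> \<in> span (?v ` {..<2 * d})"
      unfolding lie_comb by (intro span_sum span_scale span_base imageI)
    finally show "lie Z y \<in> span (?v ` {..<2 * d})" .
  qed
  moreover have "inj_on ?v {..<2 * d}" by (rule independent_family(1)) (rule zero)
  moreover have "independent (?v ` {..<2 * d})" by (rule independent_family(2)) (rule zero)
  ultimately show ?thesis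
    by (intro dim_unique[of "?v ` {..<2 * d}"]) (auto simp: orbit_tangent_eq_range card_image)
qed

text \<open>Quantitative form of the transversality of the frame to the centralizer: the projection along
  the centralizer maps \<open>c + A c\<close> to the projection of \<open>A c\<close>, which is small.\<close>

lemma transversal_near_one:
  "\<exists>\<delta>>0. \<forall>A. norm A < \<delta> \<longrightarrow> (\<forall>Z c. lie Z y = 0 \<longrightarrow> (mat 1 + A) ** Z = comb c \<longrightarrow> Z = 0)"
proof -
  define Q where "Q Z = comb (\<lambda>i. coef i Z)" for Z
  have linQ: "linear Q"
    unfolding Q_def comb_def
    by (rule linearI) (simp_all add: linear_add[OF coef_linear] linear_scale[OF coef_linear]
      scaleR_left_distrib sum.distrib scaleR_sum_right)
  then obtain K where K: "\<And>Z. norm (Q Z) \<le> K * norm Z"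
    using linear_bounded_pos by (metis)
  obtain M where M: "M > 0" "\<And>(A :: real^'n^'n) (B :: real^'n^'n). norm (A ** B) \<le> norm A * norm B * M"
    using bounded_bilinear.pos_bounded[OF bounded_bilinear_matrix_mult] by blast
  \<comment> \<open>\<open>K\<close> bounds the projection and \<open>M\<close> the matrix product;
    below this radius the factor in the final estimate of \<open>norm Z\<close> is less than
    1.\<close>
  define \<delta> where "\<delta> = 1 / ((\<bar>K\<bar> + 1) * M)"
  have "Z = 0" if A: "norm A < \<delta>" and Z: "lie Z y = 0" "(mat 1 + A) ** Z = comb c" for A Z c
  proof -
    have "Q (comb c) = (\<Sum>i<2 * d. coef i (comb c) *\<^sub>R X i)"
      by (simp only: Q_def comb_def[of "\<lambda>i. coef i (comb c)"])
    also have "\<dots> = comb c"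
      unfolding comb_def[of c] by (intro sum.cong refl) (simp add: coef_comb flip: comb_def[of c])
    finally have "Q (comb c) = comb c" .
    moreover have "Q Z = 0" by (simp add: Q_def comb_def coef_centralizer[OF Z(1)])
    moreover have sum: "Z + A ** Z = comb c" using Z(2) by (simp add: matrix_ring_simps)
    ultimately have "comb c = Q (A ** Z)"
      using linear_add[OF linQ, of Z "A ** Z"] by simp
    \<comment> \<open>The projection \<open>Q\<close> kills \<open>Z\<close> and fixes
      \<open>comb c\<close>, so \<open>Z\<close> is expressed through the small term
      \<open>A ** Z\<close> alone.\<close>
    then have "Z = Q (A ** Z) - A ** Z" using sum by (simp add: algebra_simps)
    then have "norm Z \<le> norm (Q (A ** Z)) + norm (A ** Z)" by (metis norm_triangle_ineq4)
    also have "\<dots> \<le> (\<bar>K\<bar> + 1) * norm (A ** Z)"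
      using K[of "A ** Z"] mult_right_mono[OF abs_ge_self[of K], of "norm (A ** Z)"] by (simp add: distrib_right)
    also have "\<dots> \<le> (\<bar>K\<bar> + 1) * (norm A * norm Z * M)"
      by (intro mult_left_mono M(2)) auto
    finally have le: "norm Z \<le> ((\<bar>K\<bar> + 1) * M * norm A) * norm Z" by (simp add: mult_ac)
    have "(\<bar>K\<bar> + 1) * M * norm A < 1"
      using A M(1) by (simp add: \<delta>_def pos_less_divide_eq mult.commute)
    then show "Z = 0"
      using le mult_strict_right_mono[of "(\<bar>K\<bar> + 1) * M * norm A" 1 "norm Z"] by fastforce
  qed
  moreover have "\<delta> > 0" using M(1) by (simp add: \<delta>_def)
  ultimately show ?thesis by blast
qed

text \<open>The Liouville coefficient of the chart before dilation. Its arguments are the matrices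
  whose fundamental fields are the coordinate vectors, so continuity in \<open>A\<close> is
  visible.\<close>

definition density_at :: "real^'n^'n \<Rightarrow> real" where
  "density_at A = wedge_power d (orb_form (conj_by y A)) (\<lambda>i. X i ** matrix_inv (mat 1 + A))"

lemma continuous_on_conj_by:
  assumes "\<And>A. A \<in> S \<Longrightarrow> det (mat 1 + A) \<noteq> 0"
  shows "continuous_on S (conj_by y)"
  unfolding conj_by_def
  by (intro continuous_on_matrix_mult continuous_on_matrix_inv continuous_intros) (use assms in auto)

lemma continuous_on_density_at:
  assumes "\<And>A. A \<in> S \<Longrightarrow> det (mat 1 + A) \<noteq> 0"
  shows "continuous_on S density_at"
  unfolding density_at_def wedge_power_def orb_form_def
  by (intro continuous_intros continuous_on_trace continuous_on_lie continuous_on_matrix_mult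
      continuous_on_matrix_inv continuous_on_conj_by) (use assms in auto)

lemma density_at_0: "density_at 0 > 0"
proof -
  have "matrix_inv (mat 1 :: real^'n^'n) = mat 1" by (rule matrix_inv_unique) simp
  then show ?thesis
    unfolding density_at_def conj_by_def by (intro wedge_power_std_symp_pos) (simp add: frame)
qed

end

section \<open>Dilated charts around a point of the orbit\<close>

lemma adjoint_orbit_eq:
  assumes "y \<in> adjoint_orbit x"
  shows "adjoint_orbit y = adjoint_orbit x"
proof -
  have sub: "adjoint_orbit b \<subseteq> adjoint_orbit a" if "b \<in> adjoint_orbit a" for a b :: "real^'n^'n"
  proof
    fix z assume "z \<in> adjoint_orbit b"
    then obtain g where "det g = 1" "z = g ** b ** matrix_inv g" by (auto simp: adjoint_orbit_def)
    then show "z \<in> adjoint_orbit a" using that mult_matrix_inv(1)[of g] by (auto intro: adjoint_orbit_conj)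
  qed
  obtain g where g: "det g = 1" "y = g ** x ** matrix_inv g"
    using assms by (auto simp: adjoint_orbit_def)
  have gg: "g ** matrix_inv g = mat 1" "matrix_inv g ** g = mat 1" using g(1) mult_matrix_inv[of g] by auto
  have "det (matrix_inv g) * det g = 1" using gg(2) by (metis det_I det_mul)
  then have "matrix_inv g ** y ** g \<in> adjoint_orbit y"
    using g(1) by (intro adjoint_orbit_conj adjoint_orbit_self gg(2)) simp
  also have "matrix_inv g ** y ** g = (matrix_inv g ** g) ** x ** (matrix_inv g ** g)"
    by (simp add: g(2) matrix_mul_assoc)
  finally have "x \<in> adjoint_orbit y" by (simp add: gg(2))
  then show ?thesis using sub assms by blast
qed

lemma lie_conj_eq_0:
  fixes y :: "real^'n^'n"
  assumes det: "det g \<noteq> 0" and Z: "lie Z (g ** y ** matrix_inv g) = 0"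
  shows "lie (matrix_inv g ** Z ** g) y = 0"
proof -
  let ?h = "matrix_inv g"
  note gg = mult_matrix_inv[OF det]
  have c: "A ** ?h ** g = A" "A ** g ** ?h = A" for A :: "real^'n^'n"
    by (simp_all add: gg flip: matrix_mul_assoc)
  have "lie (?h ** Z ** g) y = ?h ** lie Z (g ** y ** ?h) ** g"
    by (simp add: lie_def matrix_ring_simps matrix_mul_assoc c gg)
  then show ?thesis using Z by (simp add: matrix_ring_simps)
qed

lemma conj_eq_imp_centralizes:
  fixes y :: "real^'n^'n"
  assumes det: "det g \<noteq> 0" "det h \<noteq> 0" and eq: "g ** y ** matrix_inv g = h ** y ** matrix_inv h"
  shows "lie (matrix_inv h ** g) y = 0"
proof -
  note gg = mult_matrix_inv[OF det(1)] and hh = mult_matrix_inv[OF det(2)]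
  have "matrix_inv h ** (g ** y ** matrix_inv g) ** g = matrix_inv h ** (h ** y ** matrix_inv h) ** g"
    by (simp only: eq)
  then have "matrix_inv h ** g ** y ** (matrix_inv g ** g) = (matrix_inv h ** h) ** y ** (matrix_inv h ** g)"
    by (simp only: matrix_mul_assoc)
  then show ?thesis by (simp add: lie_def gg hh matrix_mul_assoc)
qed

lemma lie_scale_right: "lie A (t *\<^sub>R B) = t *\<^sub>R lie A B"
  by (simp add: lie_def matrix_ring_simps scaleR_diff_right)

lemma lie_one_left: "lie (mat 1) y = 0"
  by (simp add: lie_def)

lemma killing_eq_trace_sl: "\<beta> \<in> sl \<Longrightarrow> killing y \<beta> = 2 * CARD('n) * trace (y ** \<beta>)"
  for \<beta> :: "real^'n^'n"
  by (simp add: killing_eq_trace sl_def)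

context orbit_frame
begin

text \<open>The first three conditions hold at \<open>A = 0\<close> and persist nearby by
  continuity; transversality has its own radius. The energy clause is conditional so that it also
  serves for \<open>\<beta> = 0\<close>.\<close>

lemma chart_domain_exists:
  "\<exists>\<epsilon>>0. \<forall>A. norm A < \<epsilon> \<longrightarrow> det (mat 1 + A) > 0 \<and> density_at A > density_at 0 / 2
    \<and> (trace (y ** \<beta>) < 0 \<longrightarrow> trace (conj_by y A ** \<beta>) < 0)
    \<and> (\<forall>Z c. lie Z y = 0 \<longrightarrow> (mat 1 + A) ** Z = comb c \<longrightarrow> Z = 0)"
proof -
  define S where "S = {A :: real^'n^'n. det (mat 1 + A) > 0}"
  have S: "open S" "0 \<in> S"
    by (auto simp: S_def intro!: open_Collect_less continuous_on_det continuous_intros)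
  have nz: "det (mat 1 + A) \<noteq> 0" if "A \<in> S" for A using that by (auto simp: S_def)
  have at0: "isCont f 0" if "continuous_on S f" for f :: "real^'n^'n \<Rightarrow> real"
    using that S by (simp add: continuous_on_eq_continuous_at)
  have "isCont density_at 0" by (intro at0 continuous_on_density_at nz)
  moreover have "density_at 0 / 2 < density_at 0" using density_at_0 by simp
  ultimately have 1: "\<forall>\<^sub>F A in nhds 0. density_at 0 / 2 < density_at A"
    unfolding isCont_def tendsto_at_iff_tendsto_nhds by (rule order_tendstoD)
  have 2: "\<forall>\<^sub>F A in nhds 0. trace (y ** \<beta>) < 0 \<longrightarrow> trace (conj_by y A ** \<beta>) < 0"
  proof (cases "trace (y ** \<beta>) < 0")
    case True
    have "matrix_inv (mat 1 :: real^'n^'n) = mat 1" by (rule matrix_inv_unique) simp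
    then have "trace (conj_by y 0 ** \<beta>) < 0" using True by (simp add: conj_by_def)
    moreover have "isCont (\<lambda>A. trace (conj_by y A ** \<beta>)) 0"
      by (intro at0 continuous_on_trace continuous_on_matrix_mult continuous_on_conj_by nz continuous_on_const)
    then have "((\<lambda>A. trace (conj_by y A ** \<beta>)) \<longlongrightarrow> trace (conj_by y 0 ** \<beta>)) (nhds 0)"
      by (simp only: isCont_def tendsto_at_iff_tendsto_nhds[where g = "\<lambda>A. trace (conj_by y A ** \<beta>)"])
    ultimately have "\<forall>\<^sub>F A in nhds 0. trace (conj_by y A ** \<beta>) < 0"
      by (intro order_tendstoD(2))
    then show ?thesis by (rule eventually_mono) simp
  qed simp
  have 3: "\<forall>\<^sub>F A in nhds 0. A \<in> S" using S by (rule eventually_nhds_in_open)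
  obtain \<delta> where \<delta>: "\<delta> > 0"
    "\<And>A Z c. norm A < \<delta> \<Longrightarrow> lie Z y = 0 \<Longrightarrow> (mat 1 + A) ** Z = comb c \<Longrightarrow> Z = 0"
    using transversal_near_one by blast
  from eventually_conj[OF 1 eventually_conj[OF 2 3]] obtain \<eta> where \<eta>: "\<eta> > 0"
    "\<And>A. norm A < \<eta> \<Longrightarrow> density_at 0 / 2 < density_at A
      \<and> (trace (y ** \<beta>) < 0 \<longrightarrow> trace (conj_by y A ** \<beta>) < 0) \<and> A \<in> S"
    unfolding eventually_nhds_metric dist_norm diff_zero by blast
  show ?thesis
  proof (intro exI[of _ "min \<delta> \<eta>"] conjI allI impI)
    show "min \<delta> \<eta> > 0" using \<delta>(1) \<eta>(1) by simp
  next
    fix A :: "real^'n^'n" assume A: "norm A < min \<delta> \<eta>"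
    then show "det (mat 1 + A) > 0" "density_at A > density_at 0 / 2"
      "trace (y ** \<beta>) < 0 \<Longrightarrow> trace (conj_by y A ** \<beta>) < 0"
      using \<eta>(2)[of A] by (auto simp: S_def)
    fix Z c assume "lie Z y = 0" "(mat 1 + A) ** Z = comb c"
    then show "Z = 0" using \<delta>(2)[of A Z c] A by simp
  qed
qed

text \<open>The dilation is applied after the conjugation, so one parameter domain serves for all
  \<open>t\<close>.\<close>

definition chart :: "real \<Rightarrow> (nat \<Rightarrow> real) \<Rightarrow> real^'n^'n" where
  "chart t u = t *\<^sub>R conj_by y (comb u)"

lemma chart_has_partial_deriv:
  assumes i: "i < 2 * d" and det: "det (mat 1 + comb u) \<noteq> 0"
  shows "((\<lambda>s. chart t (u(i := s))) has_vector_derivative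
    lie (X i ** matrix_inv (mat 1 + comb u)) (chart t u)) (at (u i))"
proof -
  have comb: "comb (u(i := s)) = comb u + (s - u i) *\<^sub>R X i" for s
  proof -
    have "comb (u(i := s)) - comb u = (\<Sum>j<2 * d. ((u(i := s)) j - u j) *\<^sub>R X j)"
      by (simp add: comb_def scaleR_diff_left sum_subtractf)
    also have "\<dots> = (\<Sum>j<2 * d. if j = i then (s - u i) *\<^sub>R X i else 0)"
      by (intro sum.cong refl) auto
    finally show ?thesis using i by (simp add: sum.delta algebra_simps)
  qed
  let ?G = "\<lambda>s. mat 1 + comb (u(i := s))"
  have "(?G has_vector_derivative X i) (at (u i))"
    unfolding comb by (auto intro!: derivative_eq_intros)
  from has_vector_derivative_conj[OF this, of y] det
  have "((\<lambda>s. ?G s ** y ** matrix_inv (?G s)) has_vector_derivative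
      lie (X i ** matrix_inv (mat 1 + comb u)) (conj_by y (comb u))) (at (u i))"
    by (simp add: conj_by_def)
  from bounded_linear.has_vector_derivative[OF bounded_linear_scaleR_right this, of t]
  show ?thesis by (simp add: chart_def conj_by_def lie_scale_right)
qed

lemma partial_deriv_chart:
  assumes "i < 2 * d" "det (mat 1 + comb u) \<noteq> 0"
  shows "partial_deriv (chart t) i u = lie (X i ** matrix_inv (mat 1 + comb u)) (chart t u)"
  unfolding partial_deriv_def by (rule vector_derivative_at[OF chart_has_partial_deriv[OF assms]])

text \<open>Dilation keeps the matrices inducing the coordinate vectors and scales only the base
  point, in which the form is linear. Each of the \<open>d\<close> factors therefore gains one
  \<open>t\<close>.\<close>

lemma chart_density:
  assumes "det (mat 1 + comb u) \<noteq> 0"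
  shows "wedge_power d (kks_form (chart t u)) (\<lambda>i. partial_deriv (chart t) i u) = t ^ d * density_at (comb u)"
  unfolding density_at_def
proof (rule wedge_power_scale)
  fix i j assume "i < 2 * d" "j < 2 * d"
  then show "kks_form (chart t u) (partial_deriv (chart t) i u) (partial_deriv (chart t) j u)
      = t * orb_form (conj_by y (comb u)) (X i ** matrix_inv (mat 1 + comb u)) (X j ** matrix_inv (mat 1 + comb u))"
    by (simp only: partial_deriv_chart[OF _ assms] kks_form_eq_orb_form) (simp only: chart_def orb_form_scale)
qed

end

section \<open>Liouville mass of a dilated chart on a cube\<close>

text \<open>A radius on which all chart conditions hold together. The energy bound is weak so that
  \<open>\<beta> = 0\<close> is included.\<close>

locale orbit_chart = orbit_frame y d X coef for y :: "real^'n^'n" and d X coef +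
  fixes \<epsilon> :: real and \<beta> :: "real^'n^'n"
  assumes \<epsilon>: "\<epsilon> > 0"
    and det_pos: "\<And>A :: real^'n^'n. norm A < \<epsilon> \<Longrightarrow> det (mat 1 + A) > 0"
    and density_bound: "\<And>A. norm A < \<epsilon> \<Longrightarrow> density_at A > density_at 0 / 2"
    and energy: "\<And>A. norm A < \<epsilon> \<Longrightarrow> trace (conj_by y A ** \<beta>) \<le> 0"
    and transversal: "\<And>A Z c. norm A < \<epsilon> \<Longrightarrow> lie Z y = 0 \<Longrightarrow> (mat 1 + A) ** Z = comb c \<Longrightarrow> Z = 0"
    and \<beta>_sl: "\<beta> \<in> sl"
begin

text \<open>Half the side of a cube that \<open>comb\<close> maps into the ball of radius
  \<open>\<epsilon>\<close>; the summand 1 keeps the denominator positive.\<close>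

definition \<delta> :: real where "\<delta> = \<epsilon> / (1 + (\<Sum>i<2 * d. norm (X i)))"

definition cube :: "(nat \<Rightarrow> real) set" where "cube = (\<Pi>\<^sub>E i\<in>{..<2 * d}. {- \<delta><..<\<delta>})"

lemma \<delta>_pos: "\<delta> > 0"
proof -
  have "1 + (\<Sum>i<2 * d. norm (X i)) > 0" by (smt (verit) norm_ge_zero sum_nonneg)
  then show ?thesis using \<epsilon> by (simp add: \<delta>_def)
qed

lemma norm_comb_less:
  assumes "u \<in> cube"
  shows "norm (comb u) < \<epsilon>"
proof -
  have pos: "1 + (\<Sum>i<2 * d. norm (X i)) > 0" by (smt (verit) norm_ge_zero sum_nonneg)
  have "norm (comb u) \<le> (\<Sum>i<2 * d. norm (u i *\<^sub>R X i))" unfolding comb_def by (rule norm_sum)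
  also have "\<dots> \<le> (\<Sum>i<2 * d. \<delta> * norm (X i))"
  proof (intro sum_mono)
    fix i assume "i \<in> {..<2 * d}"
    then have "u i \<in> {- \<delta><..<\<delta>}" using assms by (auto simp: cube_def PiE_iff)
    then show "norm (u i *\<^sub>R X i) \<le> \<delta> * norm (X i)" by (auto intro!: mult_right_mono)
  qed
  also have "\<dots> = \<delta> * (\<Sum>i<2 * d. norm (X i))" by (simp add: sum_distrib_left)
  also have "\<dots> < \<delta> * (1 + (\<Sum>i<2 * d. norm (X i)))" using \<delta>_pos by simp
  also have "\<dots> = \<epsilon>" using pos by (simp add: \<delta>_def)
  finally show ?thesis .
qed

lemmas det_pos_cube = det_pos[OF norm_comb_less]

lemma det_nz_cube: "u \<in> cube \<Longrightarrow> det (mat 1 + comb u) \<noteq> 0"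
  using det_pos_cube[of u] by simp

text \<open>Equal values make the quotient of the two conjugating matrices centralize
  \<open>y\<close>. So does the quotient minus 1, which the second matrix multiplies to a
  combination of the frame; transversality makes it 0.\<close>

lemma inj_on_chart:
  assumes t: "t \<noteq> 0"
  shows "inj_on (chart t) cube"
proof (rule inj_onI)
  fix u v assume u: "u \<in> cube" and v: "v \<in> cube" and eq: "chart t u = chart t v"
  let ?g = "mat 1 + comb u" and ?h = "mat 1 + comb v"
  have "lie (matrix_inv ?h ** ?g) y = 0"
    using eq t by (intro conj_eq_imp_centralizes det_nz_cube u v) (simp add: chart_def conj_by_def)
  then have "lie (matrix_inv ?h ** ?g - mat 1) y = 0"
    using lie_one_left[of y] by (simp add: lie_def matrix_ring_simps)
  moreover have "?h ** (matrix_inv ?h ** ?g - mat 1) = comb (\<lambda>i. u i - v i)"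
  proof -
    have "?h ** (matrix_inv ?h ** ?g - mat 1) = (?h ** matrix_inv ?h) ** ?g - ?h"
      by (simp only: matrix_ring_simps(4) matrix_mul_assoc matrix_mul_rid)
    also have "\<dots> = comb u - comb v" using mult_matrix_inv(1)[OF det_nz_cube[OF v]] by simp
    finally show ?thesis by (simp add: comb_def scaleR_diff_left sum_subtractf)
  qed
  ultimately have "matrix_inv ?h ** ?g - mat 1 = 0" and c: "?h ** 0 = comb (\<lambda>i. u i - v i)"
    using transversal[OF norm_comb_less[OF v]] by metis+
  then have "u i = v i" if "i < 2 * d" for i
    using coef_comb[OF that, of "\<lambda>i. u i - v i"] linear_0[OF coef_linear] by (simp add: matrix_ring_simps)
  then show "u = v"
    using u v by (intro PiE_ext[of u "{..<2 * d}" _ v]) (auto simp: cube_def)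
qed

text \<open>Undoing the conjugation turns a linear relation into a centralizing matrix
  \<open>matrix_inv (mat 1 + comb u) ** comb c\<close>, to which transversality applies.\<close>

lemma chart_partial_derivs_independent:
  assumes t: "t \<noteq> 0" and u: "u \<in> cube" and c: "(\<Sum>i<2 * d. c i *\<^sub>R partial_deriv (chart t) i u) = 0" and k: "k < 2 * d"
  shows "c k = 0"
proof -
  let ?g = "mat 1 + comb u"
  note det = det_nz_cube[OF u]
  have lin: "linear (\<lambda>W. lie (W ** matrix_inv ?g) (chart t u))"
    by (rule linearI) (simp_all add: lie_def matrix_ring_simps scaleR_diff_right)
  have "(\<Sum>i<2 * d. c i *\<^sub>R partial_deriv (chart t) i u) = lie (comb c ** matrix_inv ?g) (chart t u)"
    by (simp add: partial_deriv_chart det comb_def[of c] linear_sum[OF lin] linear_scale[OF lin])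
  then have "t *\<^sub>R lie (comb c ** matrix_inv ?g) (conj_by y (comb u)) = 0"
    using c by (simp add: chart_def lie_scale_right)
  then have "lie (comb c ** matrix_inv ?g) (?g ** y ** matrix_inv ?g) = 0"
    using t by (simp add: conj_by_def)
  from lie_conj_eq_0[OF det this]
  have 0: "lie (matrix_inv ?g ** comb c) y = 0"
    using mult_matrix_inv(2)[OF det] by (simp flip: matrix_mul_assoc)
  moreover have g: "?g ** (matrix_inv ?g ** comb c) = comb c"
    using mult_matrix_inv(1)[OF det] by (simp add: matrix_mul_assoc)
  ultimately have "matrix_inv ?g ** comb c = 0" by (rule transversal[OF norm_comb_less[OF u]])
  then have "comb c = 0" using g by (simp add: matrix_ring_simps)
  then show ?thesis using coef_comb[OF k, of c] linear_0[OF coef_linear] by simp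
qed

lemma continuous_on_comb: "continuous_on S comb"
  unfolding comb_def
  by (intro continuous_intros continuous_on_subset[OF continuous_on_product_coordinates]) auto

lemma continuous_on_chart: "continuous_on cube (chart t)"
proof -
  have "continuous_on (comb ` cube) (conj_by y)"
    by (rule continuous_on_conj_by) (auto dest: det_nz_cube)
  from continuous_on_compose2[OF this continuous_on_comb]
  show ?thesis unfolding chart_def by (intro continuous_on_scaleR continuous_on_const) auto
qed

lemma local_parametrization_chart:
  assumes orb: "t *\<^sub>R y \<in> adjoint_orbit x" and t: "t \<noteq> 0"
  shows "local_parametrization (2 * d) (adjoint_orbit x) cube (chart t)"
  unfolding local_parametrization_def
proof (intro conjI allI impI ballI)
  show "openin (product_topology (\<lambda>_. euclideanreal) {..<2 * d}) cube"
    unfolding cube_def by (subst openin_PiE_gen) auto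
  show "chart t ` cube \<subseteq> adjoint_orbit x"
  proof clarify
    fix u assume "u \<in> cube"
    then have "(mat 1 + comb u) ** (t *\<^sub>R y) ** matrix_inv (mat 1 + comb u) \<in> adjoint_orbit x"
      by (intro adjoint_orbit_conj orb det_pos_cube mult_matrix_inv det_nz_cube)
    then show "chart t u \<in> adjoint_orbit x" by (simp add: chart_def conj_by_def matrix_ring_simps)
  qed
  show "inj_on (chart t) cube" by (rule inj_on_chart[OF t])
  show "continuous_on cube (chart t)" by (rule continuous_on_chart)
  show "(\<lambda>s. chart t (u(i := s))) differentiable at (u i)" if "i < 2 * d" "u \<in> cube" for i u
    using differentiableI_vector[OF chart_has_partial_deriv] that det_nz_cube by blast
  show "continuous_on cube (partial_deriv (chart t) i)" if "i < 2 * d" for i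
  proof (rule continuous_on_eq)
    show "continuous_on cube (\<lambda>u. lie (X i ** matrix_inv (mat 1 + comb u)) (chart t u))"
      by (intro continuous_on_lie continuous_on_matrix_mult continuous_on_matrix_inv continuous_on_chart
          continuous_intros continuous_on_comb) (auto dest: det_nz_cube)
  qed (use that in \<open>simp add: partial_deriv_chart det_nz_cube\<close>)
  show "inj_on (\<lambda>i. partial_deriv (chart t) i u) {..<2 * d}"
    "independent ((\<lambda>i. partial_deriv (chart t) i u) ` {..<2 * d})" if "u \<in> cube" for u
    by (rule independent_family, erule (1) chart_partial_derivs_independent[OF t that])+
qed

abbreviation coords :: "(nat \<Rightarrow> real) measure" where
  "coords \<equiv> Pi\<^sub>M {..<2 * d} (\<lambda>_. lborel)"

lemma cube_sets: "cube \<in> sets coords"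
  unfolding cube_def by (intro sets_PiM_I_finite) auto

lemma emeasure_cube: "emeasure coords cube = ennreal ((2 * \<delta>) ^ (2 * d))"
proof -
  interpret product_sigma_finite "\<lambda>_ :: nat. lborel :: real measure" by standard
  have "emeasure coords cube = (\<Prod>i<2 * d. emeasure lborel {- \<delta><..<\<delta>})"
    unfolding cube_def by (rule emeasure_PiM) auto
  then show ?thesis using \<delta>_pos by (simp add: prod_constant ennreal_power)
qed

text \<open>The target is the ball because the chart and its density are known to be continuous only
  where \<open>mat 1 + A\<close> is invertible.\<close>

lemma measurable_comb_cube: "comb \<in> measurable (restrict_space coords cube) (restrict_space borel (ball 0 \<epsilon>))"
proof (rule measurable_restrict_space2)
  show "comb \<in> space (restrict_space coords cube) \<rightarrow> ball 0 \<epsilon>"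
    using norm_comb_less by (auto simp: space_restrict_space)
  have "(\<lambda>u. u i) \<in> borel_measurable coords" if "i < 2 * d" for i
    using measurable_component_singleton[of i "{..<2 * d}" "\<lambda>_. lborel"] that by simp
  then have "comb \<in> borel_measurable coords"
    unfolding comb_def by (intro borel_measurable_sum borel_measurable_scaleR borel_measurable_const) auto
  then show "comb \<in> borel_measurable (restrict_space coords cube)" by (rule measurable_restrict_space1)
qed

lemma measurable_comp_comb:
  assumes "continuous_on (ball 0 \<epsilon>) f"
  shows "(\<lambda>u. f (comb u)) \<in> borel_measurable (restrict_space coords cube)"
  using measurable_comb_cube borel_measurable_continuous_on_restrict[OF assms] by (rule measurable_compose)

lemma measurable_chart: "chart t \<in> borel_measurable (restrict_space coords cube)"
  unfolding chart_def[abs_def]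
  by (intro borel_measurable_scaleR borel_measurable_const measurable_comp_comb continuous_on_conj_by)
    (use det_pos in force)

lemma space_cube: "space (restrict_space coords cube) = cube"
  using sets.sets_into_space[OF cube_sets] by (auto simp: space_restrict_space)

text \<open>On the cube the energy is nonpositive, so the integrand is at least 1, and the density
  is at least \<open>t ^ d\<close> times half its value at the centre. The remaining factor is the
  volume of the cube.\<close>

lemma chart_integral_bound:
  assumes t: "t > 0"
  shows "ennreal (t ^ d * (density_at 0 / 2 * (2 * \<delta>) ^ (2 * d)))
    \<le> (\<integral>\<^sup>+ z. ennreal (exp (- killing z \<beta>)) \<partial>chart_measure d cube (chart t))"
proof -
  let ?M = "restrict_space coords cube"
  let ?w = "\<lambda>u. ennreal \<bar>wedge_power d (kks_form (chart t u)) (\<lambda>i. partial_deriv (chart t) i u)\<bar>"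
  let ?e = "\<lambda>z. ennreal (exp (- killing z \<beta>))"
  have w: "?w u = ennreal \<bar>t ^ d * density_at (comb u)\<bar>" if "u \<in> cube" for u
    using that by (simp add: chart_density det_nz_cube)
  have "(\<lambda>u. ennreal \<bar>t ^ d * density_at (comb u)\<bar>) \<in> borel_measurable ?M"
    by (intro measurable_compose[OF _ measurable_ennreal] borel_measurable_abs borel_measurable_times
        borel_measurable_const measurable_comp_comb continuous_on_density_at) (use det_pos in force)
  then have w_meas: "?w \<in> borel_measurable ?M"
    using w by (subst measurable_cong) (auto simp: space_cube)
  have "continuous_on UNIV (\<lambda>z. exp (- killing z \<beta>))"
    unfolding killing_eq_trace_sl[OF \<beta>_sl]
    by (intro continuous_intros continuous_on_trace continuous_on_matrix_mult)
  then have e_meas: "?e \<in> borel_measurable borel"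
    by (intro measurable_compose[OF _ measurable_ennreal] borel_measurable_continuous_onI)
  have "(\<integral>\<^sup>+ z. ?e z \<partial>chart_measure d cube (chart t)) = (\<integral>\<^sup>+ u. ?e (chart t u) \<partial>density ?M ?w)"
    unfolding chart_measure_def using measurable_chart e_meas by (intro nn_integral_distr) auto
  also have "\<dots> = (\<integral>\<^sup>+ u. ?w u * ?e (chart t u) \<partial>?M)"
    using w_meas measurable_compose[OF measurable_chart e_meas] by (rule nn_integral_density)
  also have "\<dots> \<ge> (\<integral>\<^sup>+ u. ennreal (t ^ d * (density_at 0 / 2)) \<partial>?M)"
  proof (rule nn_integral_mono)
    fix u assume "u \<in> space ?M"
    then have u: "u \<in> cube" by (simp add: space_cube)
    have "killing (chart t u) \<beta> \<le> 0"
      unfolding killing_eq_trace_sl[OF \<beta>_sl] using energy[OF norm_comb_less[OF u]] t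
      by (simp add: chart_def matrix_ring_simps trace_linear_simps mult_nonneg_nonpos)
    then have "1 \<le> ?e (chart t u)" by simp
    moreover have "ennreal (t ^ d * (density_at 0 / 2)) \<le> ?w u"
      unfolding w[OF u] using density_bound[OF norm_comb_less[OF u]] density_at_0 t
      by (intro ennreal_leI) (simp add: abs_mult)
    ultimately show "ennreal (t ^ d * (density_at 0 / 2)) \<le> ?w u * ?e (chart t u)"
      using mult_mono[of "ennreal (t ^ d * (density_at 0 / 2))" "?w u" 1 "?e (chart t u)"] by simp
  qed
  also have "(\<integral>\<^sup>+ u. ennreal (t ^ d * (density_at 0 / 2)) \<partial>?M)
      = ennreal (t ^ d * (density_at 0 / 2)) * emeasure coords cube"
    using cube_sets sets.sets_into_space[OF cube_sets]
    by (simp add: space_cube emeasure_restrict_space)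
  also have "\<dots> = ennreal (t ^ d * (density_at 0 / 2 * (2 * \<delta>) ^ (2 * d)))"
    using t density_at_0 \<delta>_pos by (simp add: emeasure_cube mult.assoc flip: ennreal_mult)
  finally show ?thesis .
qed

end

section \<open>Divergence of the partition function\<close>

text \<open>Dimension zero would make \<open>x\<close> commute with the matrix \<open>h\<close> that
  dilates it by 4, forcing \<open>x = 4 x\<close>. Positive dimension is what makes
  \<open>t ^ d\<close> grow with \<open>t\<close>.\<close>

lemma orbit_dim_pos:
  fixes x :: "real^'n^'n"
  assumes "nilpotent_mat x" "x \<noteq> 0"
  shows "dim (orbit_tangent x) \<noteq> 0"
proof
  assume "dim (orbit_tangent x) = 0"
  then have central: "lie Z x = 0" for Z
    by (auto simp: orbit_tangent_eq_range dim_eq_0)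
  obtain h where h: "det h > 0" "h ** x = 4 *\<^sub>R (x ** h)" using nilpotent_mat_dilation[OF assms(1)] .
  have "h ** x = x ** h" using central[of h] by (simp add: lie_def)
  then have "x ** h = 4 *\<^sub>R (x ** h)" using h(2) by simp
  then have "x ** h = 0" by (metis eq_vector_fraction_iff scaleR_cancel_right scaleR_one numeral_eq_one_iff semiring_norm(83))
  then have "x ** (h ** matrix_inv h) = 0" by (simp add: matrix_mul_assoc matrix_ring_simps)
  then show False using h(1) assms(2) mult_matrix_inv(1)[of h] by simp
qed

text \<open>The Liouville measure dominates every chart measure, so each dilated chart alone bounds
  the partition function from below. The bounds for \<open>t = 4 ^ m\<close> are unbounded in
  \<open>m\<close>.\<close>

lemma partition_function_infinite:
  fixes x y \<beta> :: "real^'n^'n"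
  assumes x: "nilpotent_mat x" "x \<noteq> 0" and y: "y \<in> adjoint_orbit x"
    and \<beta>: "\<beta> \<in> sl" "\<beta> = 0 \<or> trace (y ** \<beta>) < 0"
  shows "partition_function (adjoint_orbit x) \<beta> = \<infinity>"
proof -
  obtain d X coef where "orbit_frame y d X coef" using orbit_frame_exists .
  then interpret orbit_frame y d X coef .
  obtain \<epsilon> where \<epsilon>: "\<epsilon> > 0" "\<forall>A. norm A < \<epsilon> \<longrightarrow> det (mat 1 + A) > 0 \<and> density_at A > density_at 0 / 2
    \<and> (trace (y ** \<beta>) < 0 \<longrightarrow> trace (conj_by y A ** \<beta>) < 0)
    \<and> (\<forall>Z c. lie Z y = 0 \<longrightarrow> (mat 1 + A) ** Z = comb c \<longrightarrow> Z = 0)"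
    using chart_domain_exists[of \<beta>] by blast
  interpret orbit_chart y d X coef \<epsilon> \<beta>
  proof (rule orbit_chart.intro[OF orbit_frame_axioms], unfold_locales)
    show "trace (conj_by y A ** \<beta>) \<le> 0" if "norm A < \<epsilon>" for A
      using \<epsilon>(2) \<beta>(2) that by (cases "\<beta> = 0") (auto simp: matrix_ring_simps trace_linear_simps intro: less_imp_le)
  qed (use \<epsilon> \<beta>(1) in blast)+
  have dim: "orbit_dim (adjoint_orbit x) = 2 * d"
    using orbit_dim_adjoint_orbit[of y] dim_orbit_tangent by (simp add: adjoint_orbit_eq[OF y])
  then have d: "d \<ge> 1"
    using orbit_dim_pos[OF x] orbit_dim_adjoint_orbit[of x] by simp
  define K where "K = density_at 0 / 2 * (2 * \<delta>) ^ (2 * d)"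
  have K: "K > 0" using density_at_0 \<delta>_pos by (simp add: K_def)
  let ?Z = "partition_function (adjoint_orbit x) \<beta>"
  have bound: "ennreal (real m * K) \<le> ?Z" for m :: nat
  proof -
    let ?t = "4 ^ m :: real"
    have "?t *\<^sub>R y \<in> adjoint_orbit x" using nilpotent_orbit_dilation[OF x(1) y] .
    then have param: "local_parametrization (2 * d) (adjoint_orbit x) cube (chart ?t)"
      by (rule local_parametrization_chart) simp
    let ?C = "{chart_measure d U \<phi> | U \<phi>. local_parametrization (2 * d) (adjoint_orbit x) U \<phi>}"
    have mem: "chart_measure d cube (chart ?t) \<in> ?C" using param by blast
    have L: "liouville_measure (adjoint_orbit x) = Sup ?C"
      by (simp add: liouville_measure_def dim Let_def)
    \<comment> \<open>The order on measures compares values only for equal \<sigma>-algebras, so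
      these must agree before the integrals can be compared.\<close>
    have "sets (SUP M\<in>?C. M) = sets borel"
      by (rule sets_SUP) (use mem in \<open>auto simp: chart_measure_def\<close>)
    then have sets: "sets (chart_measure d cube (chart ?t)) = sets (Sup ?C)"
      by (simp add: chart_measure_def)
    have "real m \<le> 4 ^ m"
    proof (induction m)
      case (Suc m)
      have "(1 :: real) \<le> 4 ^ m" by simp
      with Suc.IH have "1 + real m \<le> 4 * 4 ^ m" by linarith
      then show ?case by simp
    qed simp
    \<comment> \<open>Positivity of the orbit dimension enters here, through
      \<open>d \<ge> 1\<close>.\<close>
    also have "(4 :: real) ^ m \<le> (4 ^ m) ^ d"
      using d by (simp add: self_le_power)
    finally have "real m * K \<le> ?t ^ d * K" using K by (simp add: mult_right_mono)
    then have "ennreal (real m * K) \<le> ennreal (?t ^ d * K)" by (rule ennreal_leI)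
    also have "\<dots> \<le> (\<integral>\<^sup>+ z. ennreal (exp (- killing z \<beta>)) \<partial>chart_measure d cube (chart ?t))"
      unfolding K_def by (rule chart_integral_bound) simp
    also have "\<dots> \<le> ?Z"
      unfolding partition_function_def L
      by (rule nn_integral_mono_measure[OF sets]) (rule Sup_upper[OF mem])
    finally show ?thesis .
  qed
  show ?thesis
  proof (rule ccontr)
    assume "?Z \<noteq> \<infinity>"
    then obtain r where r: "r \<ge> 0" "?Z = ennreal r"
      by (cases ?Z) auto
    obtain m :: nat where "r < real m * K" using reals_Archimedean3[OF K] by blast
    then have "ennreal r < ennreal (real m * K)" using r(1) by (simp add: ennreal_lessI)
    then show False using bound[of m] r(2) by simp
  qed
qed

theorem theorem4p8:
  fixes x :: "real^'n^'n"
  assumes "x \<in> sl" and "nilpotent_mat x" and "nilpotency_index x > 2"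
  shows "gibbs_states (adjoint_orbit x) = {} \<and> generalized_temperatures (adjoint_orbit x) = {}"
proof -
  have "x \<noteq> 0"
  proof
    assume "x = 0"
    then have "matpow x 1 = 0" by (simp add: matpow_def)
    then have "nilpotency_index x \<le> 1" unfolding nilpotency_index_def by (rule Least_le)
    then show False using assms(3) by simp
  qed
  have "partition_function (adjoint_orbit x) \<beta> = \<infinity>" if \<beta>: "\<beta> \<in> sl" for \<beta>
  proof (cases "\<beta> = 0")
    case True
    then show ?thesis
      using partition_function_infinite[OF assms(2) \<open>x \<noteq> 0\<close> adjoint_orbit_self \<beta>] by simp
  next
    case False
    obtain y where "y \<in> adjoint_orbit x" "trace (y ** \<beta>) < 0"
      using orbit_negative_direction[OF assms(2,3) \<beta> False] .
    then show ?thesis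
      using partition_function_infinite[OF assms(2) \<open>x \<noteq> 0\<close> _ \<beta>] by blast
  qed
  then have "generalized_temperatures (adjoint_orbit x) = {}"
    by (auto simp: generalized_temperatures_def)
  then show ?thesis by (simp add: gibbs_states_def)
qed

end
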